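(* Let $\alpha>0$, $L>0$, $C_Z>0$, $0<\beta_0\le1$, $\sigma_0^2>0$. Assume that in the functional data model described in the context the errors $\varepsilon_{i,\boldsymbol j}$ are i.i.d. $\mathcal N(0,\sigma_0^2)$-distributed, and that the design points are generated by design densities as described in the context. Set $$a_{n,\boldsymbol p}=\max\Big\{\boldsymbol p_{\min}^{-\alpha},\ \Big(\frac{\log(n\boldsymbol p^{\boldsymbol 1})}{n\boldsymbol p^{\boldsymbol 1}}\Big)^{\frac{\alpha}{2\alpha+d}},\ n^{-1/2}\Big\}.$$ Then there is a constant $c>0$ such that $$\liminf_{n,\boldsymbol p\to\infty}\ \inf_{\hat\mu_{n,\boldsymbol p}}\ \sup_{\mu\in\mathcal H_T(\alpha,L),\ Z\in\mathcal P_T(\beta_0,C_Z)}\mathbb E_{\mu,Z}\Big[a_{n,\boldsymbol p}^{-1}\,\|\hat\mu_{n,\boldsymbol p}-\mu\|_\infty\Big]\ \ge\ c>0,$$ where the infimum is taken over all estimators $\hat\mu_{n,\boldsymbol p}$ of $\mu$ (based on the observations $Y_{i,\boldsymbol j}$), and $n,\boldsymbol p\to\infty$ means $n\to\infty$ and $\boldsymbol p_{\min}\to\infty$.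
   Context: Notation. $T=[0,1]^d$; $\|\cdot\|_\infty$ is the sup-norm on $T$ for functions and the max-norm for vectors. $\lfloor\alpha\rfloor=\max\{k\in\mathbb N_0: k<\alpha\}$. For $\boldsymbol p=(p_1,\dots,p_d)$: $\boldsymbol p^{\boldsymbol 1}=\prod_k p_k$, $\boldsymbol p_{\min}=\min_k p_k$. Model. One observes $Y_{i,\boldsymbol j}=\mu(\boldsymbol x_{\boldsymbol j})+Z_i(\boldsymbol x_{\boldsymbol j})+\varepsilon_{i,\boldsymbol j}$, $i=1,\dots,n$, $\boldsymbol j=(j_1,\dots,j_d)$ with $1\le j_k\le p_k$, at deterministic design points $\boldsymbol x_{\boldsymbol j}=(x_{1,j_1},\dots,x_{d,j_d})\in T$. $Z_1,\dots,Z_n$ are i.i.d. copies of a centered square-integrable random field $Z$ on $T$, independent of the errors. $\mathbb E_{\mu,Z}$ is expectation under mean function $\mu$ and process distribution $Z$. Design densities. There are Lipschitz continuous probability densities $f_k:[0,1]\to\mathbb R$, $k=1,\dots,d$, with $0<f_{k,\min}\le f_k(t)\le f_{k,\max}<\infty$ for $t\in[0,1]$, such that $\int_0^{x_{k,l}}f_k(t)\,\mathrm dt=\frac{l-0.5}{p_k}$ for $l=1,\dots,p_k$, $k=1,\dots,d$. Hölder class. $\mathcal H_T(\alpha,L)$ is the set of $f:T\to\mathbb R$ with $\|f\|_{\mathcal H,\alpha}\le L$, where $\|f\|_{\mathcal H,\alpha}=\max_{|\boldsymbol\beta|\le\lfloor\alpha\rfloor}\sup_{\boldsymbol x}|\partial^{\boldsymbol\beta}f(\boldsymbol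 x)|+\max_{|\boldsymbol\beta|=\lfloor\alpha\rfloor}\sup_{\boldsymbol x\ne\boldsymbol y}\frac{|\partial^{\boldsymbol\beta}f(\boldsymbol x)-\partial^{\boldsymbol\beta}f(\boldsymbol y)|}{\|\boldsymbol x-\boldsymbol y\|_\infty^{\alpha-\lfloor\alpha\rfloor}}$ (with $|\boldsymbol\beta|=\beta_1+\dots+\beta_d$). Process class. $\mathcal P_T(\beta_0,C_Z)$ is the set of (centered, square-integrable) random fields $Z$ on $T$ for which there are $\beta\in[\beta_0,1]$ and a random variable $M>0$ with $\mathbb E[M^2]+\mathbb E[Z(\boldsymbol 0)^2]\le C_Z$ and, almost surely, $|Z(\boldsymbol x)-Z(\boldsymbol y)|\le M\|\boldsymbol x-\boldsymbol y\|_\infty^\beta$ for all $\boldsymbol x,\boldsymbol y\in T$. *)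

theory Defs
  imports "HOL-Probability.Probability"
begin

abbreviation cube :: "(real ^ 'd) set" where
  "cube \<equiv> cbox 0 1"

definition sup_norm :: "(real ^ 'd \<Rightarrow> real) \<Rightarrow> ennreal" where
  "sup_norm g = (SUP x\<in>cube. ennreal \<bar>g x\<bar>)"


subsection \<open>Hoelder classes\<close>

text \<open>The largest integer \<^emph>\<open>strictly\<close> below \<open>\<alpha>\<close>; the defining set is finite and nonempty
  for \<open>\<alpha> > 0\<close>.\<close>

definition strict_floor :: "real \<Rightarrow> nat" where
  "strict_floor \<alpha> = Max {k. real k < \<alpha>}"

definition mi_order :: "('d::finite \<Rightarrow> nat) \<Rightarrow> nat" where
  "mi_order \<beta> = (\<Sum>k\<in>UNIV. \<beta> k)"

text \<open>\<open>D \<beta>\<close> is the partial derivative of \<open>g\<close> on the cube for the multi-index \<open>\<beta>\<close>, for all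
  \<open>\<beta>\<close> of order at most \<open>m\<close>; derivatives are one-sided on the boundary.  Since partial
  derivatives are unique, \<open>D \<beta>\<close> is determined by \<open>g\<close> on the cube for these \<open>\<beta>\<close>.
  Mixed derivatives taken in different orders are required to agree, which is automatic when
  they are continuous, as they are for functions of finite Hoelder norm.\<close>

definition partial_derivs ::
  "nat \<Rightarrow> (real ^ 'd \<Rightarrow> real) \<Rightarrow> (('d::finite \<Rightarrow> nat) \<Rightarrow> real ^ 'd \<Rightarrow> real) \<Rightarrow> bool" where
  "partial_derivs m g D \<longleftrightarrow>
     (\<forall>x\<in>cube. D (\<lambda>_. 0) x = g x) \<and>
     (\<forall>\<beta> k. mi_order \<beta> < m \<longrightarrow>
        (\<forall>x\<in>cube. ((\<lambda>s. D \<beta> (\<chi> i. if i = k then s else x $ i))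
            has_real_derivative D (\<beta>(k := Suc (\<beta> k))) x) (at (x $ k) within {0..1})))"

text \<open>The Hoelder norm in terms of the family of partial derivatives, as an extended number.\<close>

definition hoelder_norm ::
  "real \<Rightarrow> (('d::finite \<Rightarrow> nat) \<Rightarrow> real ^ 'd \<Rightarrow> real) \<Rightarrow> ennreal" where
  "hoelder_norm \<alpha> D =
     (SUP \<beta>\<in>{\<beta>. mi_order \<beta> \<le> strict_floor \<alpha>}. sup_norm (D \<beta>)) +
     (SUP \<beta>\<in>{\<beta>. mi_order \<beta> = strict_floor \<alpha>}.
        SUP (x, y)\<in>{(x, y). x \<in> cube \<and> y \<in> cube \<and> x \<noteq> y}.
          ennreal (\<bar>D \<beta> x - D \<beta> y\<bar> / infnorm (x - y) powr (\<alpha> - real (strict_floor \<alpha>))))"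

definition hoelder_class :: "real \<Rightarrow> real \<Rightarrow> (real ^ 'd::finite \<Rightarrow> real) set" where
  "hoelder_class \<alpha> L =
     {g. \<exists>D. partial_derivs (strict_floor \<alpha>) g D \<and> hoelder_norm \<alpha> D \<le> ennreal L}"


subsection \<open>Random fields\<close>

text \<open>A supremum cannot range over probability spaces of all types, so a sample type is fixed.
  It is large enough: a random field \<open>Z\<close> and a random variable \<open>M\<close> on an arbitrary complete
  probability space are carried by \<open>\<omega> \<mapsto> (Z \<omega>, M \<omega>)\<close> to a space with these sample points,
  equipped with the image measure on the final sigma-algebra, without changing the joint law or
  any almost sure statement.  The sigma-algebra of a space of this type is arbitrary; in
  particular it may be larger than the product sigma-algebra, for which path properties such as
  Hoelder continuity could not hold almost surely.\<close>

type_synonym 'd sample = "(real ^ 'd \<Rightarrow> real) \<times> real"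

type_synonym 'd field = "'d sample measure \<times> ('d sample \<Rightarrow> real ^ 'd \<Rightarrow> real)"

definition centered_field :: "'w measure \<Rightarrow> ('w \<Rightarrow> real ^ 'd \<Rightarrow> real) \<Rightarrow> bool" where
  "centered_field \<Omega> Z \<longleftrightarrow> prob_space \<Omega> \<and>
     (\<forall>x\<in>cube. (\<lambda>\<omega>. Z \<omega> x) \<in> borel_measurable \<Omega> \<and>
        integrable \<Omega> (\<lambda>\<omega>. (Z \<omega> x)\<^sup>2) \<and> (\<integral>\<omega>. Z \<omega> x \<partial>\<Omega>) = 0)"

definition process_class :: "real \<Rightarrow> real \<Rightarrow> 'd::finite field set" where
  "process_class \<beta>\<^sub>0 C\<^sub>Z =
     {(\<Omega>, Z). centered_field \<Omega> Z \<and>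
       (\<exists>\<beta>\<in>{\<beta>\<^sub>0..1}. \<exists>M\<in>borel_measurable \<Omega>.
          (\<forall>\<omega>\<in>space \<Omega>. M \<omega> > 0) \<and> integrable \<Omega> (\<lambda>\<omega>. (M \<omega>)\<^sup>2) \<and>
          (\<integral>\<omega>. (M \<omega>)\<^sup>2 \<partial>\<Omega>) + (\<integral>\<omega>. (Z \<omega> 0)\<^sup>2 \<partial>\<Omega>) \<le> C\<^sub>Z \<and>
          (AE \<omega> in \<Omega>. \<forall>x\<in>cube. \<forall>y\<in>cube.
             \<bar>Z \<omega> x - Z \<omega> y\<bar> \<le> M \<omega> * infnorm (x - y) powr \<beta>))}"


subsection \<open>Design\<close>

definition design_density :: "(real \<Rightarrow> real) \<Rightarrow> bool" where
  "design_density f \<longleftrightarrow>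
     (\<exists>C. C-lipschitz_on {0..1} f) \<and> (f has_integral 1) {0..1} \<and>
     (\<exists>f_min f_max. 0 < f_min \<and> (\<forall>t\<in>{0..1}. f_min \<le> f t \<and> f t \<le> f_max))"

text \<open>\<open>x k m l\<close> is the \<open>l\<close>-th design point in coordinate \<open>k\<close> when there are \<open>m\<close> of them.\<close>

definition generated_design ::
  "('d \<Rightarrow> real \<Rightarrow> real) \<Rightarrow> ('d \<Rightarrow> nat \<Rightarrow> nat \<Rightarrow> real) \<Rightarrow> bool" where
  "generated_design f x \<longleftrightarrow>
     (\<forall>k m l. 1 \<le> l \<and> l \<le> m \<longrightarrow>
        x k m l \<in> {0..1} \<and> (f k has_integral (real l - 1/2) / real m) {0..x k m l})"

definition design_point ::
  "('d::finite \<Rightarrow> nat \<Rightarrow> nat \<Rightarrow> real) \<Rightarrow> ('d \<Rightarrow> nat) \<Rightarrow> ('d \<Rightarrow> nat) \<Rightarrow> real ^ 'd" where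
  "design_point x p j = (\<chi> k. x k (p k) (j k))"


subsection \<open>Observations and estimators\<close>

definition obs_index :: "nat \<Rightarrow> ('d \<Rightarrow> nat) \<Rightarrow> (nat \<times> ('d \<Rightarrow> nat)) set" where
  "obs_index n p = {1..n} \<times> {j. \<forall>k. 1 \<le> j k \<and> j k \<le> p k}"

abbreviation obs_space :: "nat \<Rightarrow> ('d \<Rightarrow> nat) \<Rightarrow> (nat \<times> ('d \<Rightarrow> nat) \<Rightarrow> real) measure" where
  "obs_space n p \<equiv> PiM (obs_index n p) (\<lambda>_. borel)"

text \<open>The joint law of the observations.  The independent copies of \<open>Z\<close> and the independent
  centered normal errors (with standard deviation \<open>\<sigma>\<close>) live on the product of the respective
  probability spaces.\<close>

definition obs_law ::
  "('d::finite \<Rightarrow> nat \<Rightarrow> nat \<Rightarrow> real) \<Rightarrow> real \<Rightarrow> nat \<Rightarrow> ('d \<Rightarrow> nat) \<Rightarrow>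
   (real ^ 'd \<Rightarrow> real) \<Rightarrow> 'w measure \<Rightarrow> ('w \<Rightarrow> real ^ 'd \<Rightarrow> real) \<Rightarrow>
   (nat \<times> ('d \<Rightarrow> nat) \<Rightarrow> real) measure" where
  "obs_law x \<sigma> n p \<mu> \<Omega> Z =
     distr
       (PiM {1..n} (\<lambda>_. \<Omega>) \<Otimes>\<^sub>M
        PiM (obs_index n p) (\<lambda>_. density lborel (\<lambda>t. ennreal (normal_density 0 \<sigma> t))))
       (obs_space n p)
       (\<lambda>(\<omega>, \<epsilon>). \<lambda>(i, j)\<in>obs_index n p.
          \<mu> (design_point x p j) + Z (\<omega> i) (design_point x p j) + \<epsilon> (i, j))"

text \<open>Estimators are only required to be measurable pointwise, which includes all Borel
  measurable maps into a function space with the sup norm.  Should the loss fail to be measurable,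
  its nonnegative integral below is the lower integral, so that a lower bound on the risk is as
  strong as under any other convention.\<close>

definition estimators ::
  "nat \<Rightarrow> ('d::finite \<Rightarrow> nat) \<Rightarrow> ((nat \<times> ('d \<Rightarrow> nat) \<Rightarrow> real) \<Rightarrow> real ^ 'd \<Rightarrow> real) set" where
  "estimators n p = {h. \<forall>t\<in>cube. (\<lambda>y. h y t) \<in> borel_measurable (obs_space n p)}"

definition p_min :: "('d::finite \<Rightarrow> nat) \<Rightarrow> nat" where
  "p_min p = Min (range p)"

definition p_prod :: "('d::finite \<Rightarrow> nat) \<Rightarrow> nat" where
  "p_prod p = (\<Prod>k\<in>UNIV. p k)"

definition rate :: "real \<Rightarrow> nat \<Rightarrow> ('d::finite \<Rightarrow> nat) \<Rightarrow> real" where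
  "rate \<alpha> n p =
     Max {real (p_min p) powr - \<alpha>,
          (ln (real n * real (p_prod p)) / (real n * real (p_prod p)))
             powr (\<alpha> / (2 * \<alpha> + real CARD('d))),
          real n powr (- 1 / 2)}"

definition scaled_risk ::
  "('d::finite \<Rightarrow> nat \<Rightarrow> nat \<Rightarrow> real) \<Rightarrow> real \<Rightarrow> real \<Rightarrow> nat \<Rightarrow> ('d \<Rightarrow> nat) \<Rightarrow>
   ((nat \<times> ('d \<Rightarrow> nat) \<Rightarrow> real) \<Rightarrow> real ^ 'd \<Rightarrow> real) \<Rightarrow>
   (real ^ 'd \<Rightarrow> real) \<Rightarrow> 'w measure \<Rightarrow> ('w \<Rightarrow> real ^ 'd \<Rightarrow> real) \<Rightarrow> ennreal" where
  "scaled_risk x \<sigma> \<alpha> n p h \<mu> \<Omega> Z =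
     (\<integral>\<^sup>+ y. ennreal (inverse (rate \<alpha> n p)) * sup_norm (\<lambda>t. h y t - \<mu> t)
        \<partial>obs_law x \<sigma> n p \<mu> \<Omega> Z)"

definition n_p_at_top :: "(nat \<times> ('d::finite \<Rightarrow> nat)) filter" where
  "n_p_at_top = sequentially \<times>\<^sub>F filtercomap p_min sequentially"

end

(* Each of the three terms of the rate is bounded separately by testing the null hypothesis mu = 0
   against an average of alternatives mu_1, ..., mu_K that take the value b at points t_1, ..., t_K.
   If the average r of the likelihood ratios satisfies E_0[r^2] <= 2, then the elementary inequality
   min(1, r) >= r - r^2/4 gives E_0[min(1, r)] >= 1/2, so no estimator has sup-norm risk below b/4.
   Term p_min^(-alpha): one Hoelder bump in a gap of the design, invisible to the observations.
   Logarithmic term: zero process and K ~ 1/h disjoint bumps of radius h along the diagonal of the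
   cube, with h chosen such that each likelihood ratio has second moment at most K.
   Term n^(-1/2): a random normal level as process, which hides a constant shift of that order. *)

theory Submission
  imports Defs
begin

section \<open>Gaussian product measures\<close>

text \<open>The logarithm comes from the number of alternatives. Let N be the number of
  observations. Against a single bump of radius h, a second moment of order 1 forces N
  h^(2\<alpha>+d) to stay bounded. In an average over K bumps with disjoint supports the cross
  moments equal 1 and each squared ratio has weight 1/K^2, so individual second moments up to K are
  affordable and N h^(2\<alpha>+d) may grow like log K. Since 1/h is a power of N up to logarithms,
  the bumps on the diagonal already give log K of order log N; a full grid of bumps would only
  change constants. That a bump meets about N h^d observations requires h to be at least 1/p_min.
  For smaller h the first term of the rate takes over. For n^(-1/2) the law of the correlated
  observations is never computed. They are an image of latent levels and errors, and the testing
  bound is applied before taking this image. There the likelihood ratio involves only n normal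
  variables, however many design points there are.\<close>

abbreviation gauss :: "real \<Rightarrow> real \<Rightarrow> real measure" where
  "gauss a \<sigma> \<equiv> density lborel (\<lambda>t. ennreal (normal_density a \<sigma> t))"

text \<open>Preimages of boxes under a coordinatewise map are boxes, and boxes determine a product
  measure.\<close>

lemma distr_PiM_componentwise:
  assumes "finite I" and M: "\<And>i. prob_space (M i)"
    and f: "\<And>i. f i \<in> measurable (M i) (N i)"
  shows "distr (PiM I M) (PiM I N) (\<lambda>x. \<lambda>i\<in>I. f i (x i)) = PiM I (\<lambda>i. distr (M i) (N i) (f i))"
proof -
  interpret M: product_prob_space M
    by (rule product_prob_spaceI) (rule M)
  interpret D: product_prob_space "\<lambda>i. distr (M i) (N i) (f i)"
    by (rule product_prob_spaceI) (intro prob_space.prob_space_distr M f)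
  have meas: "(\<lambda>x. \<lambda>i\<in>I. f i (x i)) \<in> measurable (PiM I M) (PiM I N)"
    using f by (intro measurable_restrict) (auto intro: measurable_compose[OF measurable_component_singleton])
  show ?thesis
  proof (rule D.PiM_eqI)
    show "finite I" by fact
    show "sets (distr (PiM I M) (PiM I N) (\<lambda>x. \<lambda>i\<in>I. f i (x i)))
        = sets (PiM I (\<lambda>i. distr (M i) (N i) (f i)))"
      by (simp, intro sets_PiM_cong) auto
    fix A assume "\<And>i. i \<in> I \<Longrightarrow> A i \<in> sets (distr (M i) (N i) (f i))"
    then have A: "A i \<in> sets (N i)" if "i \<in> I" for i using that by simp
    have "emeasure (distr (PiM I M) (PiM I N) (\<lambda>x. \<lambda>i\<in>I. f i (x i))) (Pi\<^sub>E I A)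
        = emeasure (PiM I M) ((\<lambda>x. \<lambda>i\<in>I. f i (x i)) -` Pi\<^sub>E I A \<inter> space (PiM I M))"
      using A \<open>finite I\<close> by (intro emeasure_distr meas sets_PiM_I_finite) auto
    also have "(\<lambda>x. \<lambda>i\<in>I. f i (x i)) -` Pi\<^sub>E I A \<inter> space (PiM I M)
        = Pi\<^sub>E I (\<lambda>i. f i -` A i \<inter> space (M i))"
      by (auto simp: space_PiM PiE_iff extensional_def)
    also have "emeasure (PiM I M) \<dots> = (\<Prod>i\<in>I. emeasure (M i) (f i -` A i \<inter> space (M i)))"
      using A f \<open>finite I\<close> by (intro M.emeasure_PiM) (auto intro: measurable_sets)
    also have "\<dots> = (\<Prod>i\<in>I. emeasure (distr (M i) (N i) (f i)) (A i))"
      using A f by (intro prod.cong refl) (simp add: emeasure_distr)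
    finally show "emeasure (distr (PiM I M) (PiM I N) (\<lambda>x. \<lambda>i\<in>I. f i (x i))) (Pi\<^sub>E I A)
        = (\<Prod>i\<in>I. emeasure (distr (M i) (N i) (f i)) (A i))" .
  qed
qed

text \<open>The indicator of a box is a product of indicators, so the integral of the product
  density over a box splits by Fubini.\<close>

lemma density_PiM:
  fixes f :: "'i \<Rightarrow> 'a \<Rightarrow> ennreal"
  assumes "finite I" and M: "\<And>i. prob_space (M i)" and D: "\<And>i. prob_space (density (M i) (f i))"
    and f [measurable]: "\<And>i. f i \<in> borel_measurable (M i)"
  shows "density (PiM I M) (\<lambda>x. \<Prod>i\<in>I. f i (x i)) = PiM I (\<lambda>i. density (M i) (f i))"
proof -
  interpret M: product_prob_space M
    by (rule product_prob_spaceI) (rule M)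
  interpret D: product_prob_space "\<lambda>i. density (M i) (f i)"
    by (rule product_prob_spaceI) (rule D)
  have meas [measurable]: "(\<lambda>x. \<Prod>i\<in>I. f i (x i)) \<in> borel_measurable (PiM I M)"
    by (intro borel_measurable_prod_ennreal)
       (auto intro: measurable_compose[OF measurable_component_singleton])
  show ?thesis
  proof (rule D.PiM_eqI)
    show "finite I" by fact
    show "sets (density (PiM I M) (\<lambda>x. \<Prod>i\<in>I. f i (x i))) = sets (PiM I (\<lambda>i. density (M i) (f i)))"
      by (simp, intro sets_PiM_cong) auto
    fix A assume "\<And>i. i \<in> I \<Longrightarrow> A i \<in> sets (density (M i) (f i))"
    then have A [measurable]: "A i \<in> sets (M i)" if "i \<in> I" for i using that by simp
    have "emeasure (density (PiM I M) (\<lambda>x. \<Prod>i\<in>I. f i (x i))) (Pi\<^sub>E I A)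
        = (\<integral>\<^sup>+x. (\<Prod>i\<in>I. f i (x i)) * indicator (Pi\<^sub>E I A) x \<partial>PiM I M)"
      using A \<open>finite I\<close> by (intro emeasure_density meas sets_PiM_I_finite) auto
    also have "\<dots> = (\<integral>\<^sup>+x. (\<Prod>i\<in>I. f i (x i) * indicator (A i) (x i)) \<partial>PiM I M)"
    proof (rule nn_integral_cong)
      fix x assume x: "x \<in> space (PiM I M)"
      have "(indicator (Pi\<^sub>E I A) x :: ennreal) = (\<Prod>i\<in>I. indicator (A i) (x i))"
        using x \<open>finite I\<close> by (auto simp: indicator_def space_PiM PiE_iff)
      then show "(\<Prod>i\<in>I. f i (x i)) * indicator (Pi\<^sub>E I A) x
          = (\<Prod>i\<in>I. f i (x i) * indicator (A i) (x i))"
        by (simp add: prod.distrib)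
    qed
    also have "\<dots> = (\<Prod>i\<in>I. \<integral>\<^sup>+t. f i t * indicator (A i) t \<partial>M i)"
      using \<open>finite I\<close> by (rule M.product_nn_integral_prod) measurable
    also have "\<dots> = (\<Prod>i\<in>I. emeasure (density (M i) (f i)) (A i))"
      using A by (intro prod.cong refl) (simp add: emeasure_density)
    finally show "emeasure (density (PiM I M) (\<lambda>x. \<Prod>i\<in>I. f i (x i))) (Pi\<^sub>E I A)
        = (\<Prod>i\<in>I. emeasure (density (M i) (f i)) (A i))" .
  qed
qed

text \<open>The Radon-Nikodym derivative of a product of normal laws with means \<open>a i\<close>
  with respect to the same product with means 0.\<close>

definition gauss_likelihood :: "real \<Rightarrow> 'i set \<Rightarrow> ('i \<Rightarrow> real) \<Rightarrow> ('i \<Rightarrow> real) \<Rightarrow> real" where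
  "gauss_likelihood \<sigma> I a y = exp (\<Sum>i\<in>I. (a i * y i - (a i)\<^sup>2 / 2) / \<sigma>\<^sup>2)"

lemma gauss_likelihood_nonneg: "0 \<le> gauss_likelihood \<sigma> I a y"
  by (simp add: gauss_likelihood_def)

lemma gauss_likelihood_measurable [measurable]:
  "gauss_likelihood \<sigma> I a \<in> borel_measurable (PiM I (\<lambda>i. gauss b \<sigma>))"
proof -
  have [measurable]: "(\<lambda>y. y i) \<in> borel_measurable (PiM I (\<lambda>i. gauss b \<sigma>))" if "i \<in> I" for i
    using measurable_component_singleton[OF that, of "\<lambda>_. gauss b \<sigma>"] by simp
  show ?thesis unfolding gauss_likelihood_def by measurable
qed

lemma gauss_eq_density:
  assumes "\<sigma> > 0"
  shows "gauss a \<sigma> = density (gauss 0 \<sigma>) (\<lambda>t. ennreal (exp ((a * t - a\<^sup>2 / 2) / \<sigma>\<^sup>2)))"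
proof -
  have "normal_density a \<sigma> t = normal_density 0 \<sigma> t * exp ((a * t - a\<^sup>2 / 2) / \<sigma>\<^sup>2)" for t
  proof -
    have "- (t - a)\<^sup>2 / (2 * \<sigma>\<^sup>2) = - t\<^sup>2 / (2 * \<sigma>\<^sup>2) + (a * t - a\<^sup>2 / 2) / \<sigma>\<^sup>2"
      using assms by (simp add: field_simps power2_eq_square)
    then have "exp (- (t - a)\<^sup>2 / (2 * \<sigma>\<^sup>2))
        = exp (- t\<^sup>2 / (2 * \<sigma>\<^sup>2)) * exp ((a * t - a\<^sup>2 / 2) / \<sigma>\<^sup>2)"
      by (simp only: exp_add)
    then show ?thesis by (simp add: normal_density_def)
  qed
  then show ?thesis
    by (subst density_density_eq) (simp_all add: ennreal_mult)
qed

lemma PiM_gauss_eq_density: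
  assumes "finite I" and "\<sigma> > 0"
  shows "PiM I (\<lambda>i. gauss (a i) \<sigma>)
    = density (PiM I (\<lambda>i. gauss 0 \<sigma>)) (\<lambda>y. ennreal (gauss_likelihood \<sigma> I a y))"
proof -
  define f where "f i t = ennreal (exp ((a i * t - (a i)\<^sup>2 / 2) / \<sigma>\<^sup>2))" for i t
  have eq: "gauss (a i) \<sigma> = density (gauss 0 \<sigma>) (f i)" for i
    unfolding f_def by (rule gauss_eq_density) fact
  have "PiM I (\<lambda>i. density (gauss 0 \<sigma>) (f i)) = density (PiM I (\<lambda>i. gauss 0 \<sigma>)) (\<lambda>y. \<Prod>i\<in>I. f i (y i))"
  proof (rule density_PiM[symmetric])
    show "prob_space (density (gauss 0 \<sigma>) (f i))" for i
      unfolding eq[symmetric] using assms by (intro prob_space_normal_density)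
    show "f i \<in> borel_measurable (gauss 0 \<sigma>)" for i
      unfolding f_def by measurable
  qed (use assms in \<open>auto intro: prob_space_normal_density\<close>)
  moreover have "(\<lambda>y. \<Prod>i\<in>I. f i (y i)) = (\<lambda>y. ennreal (gauss_likelihood \<sigma> I a y))"
    using \<open>finite I\<close> by (auto simp: f_def gauss_likelihood_def exp_sum prod_ennreal)
  ultimately show ?thesis by (simp add: eq)
qed

lemma nn_integral_gauss_likelihood:
  assumes "finite I" and "\<sigma> > 0"
  shows "(\<integral>\<^sup>+y. ennreal (gauss_likelihood \<sigma> I a y) \<partial>PiM I (\<lambda>i. gauss 0 \<sigma>)) = 1"
proof -
  interpret prob_space "PiM I (\<lambda>i. gauss (a i) \<sigma>)"
    using assms by (intro prob_space_PiM prob_space_normal_density)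
  let ?P = "PiM I (\<lambda>i. gauss 0 \<sigma>)"
  have "1 = emeasure (density ?P (\<lambda>y. ennreal (gauss_likelihood \<sigma> I a y))) (space ?P)"
    using emeasure_space_1 unfolding PiM_gauss_eq_density[OF assms, of a] space_density by (rule sym)
  also have "\<dots> = (\<integral>\<^sup>+y. ennreal (gauss_likelihood \<sigma> I a y) * indicator (space ?P) y \<partial>?P)"
    by (rule emeasure_density) measurable
  also have "\<dots> = (\<integral>\<^sup>+y. ennreal (gauss_likelihood \<sigma> I a y) \<partial>?P)"
    by (rule nn_integral_cong) simp
  finally show ?thesis by (rule sym)
qed

text \<open>Completing the square turns the product of the ratios for \<open>a\<close> and
  \<open>b\<close> into a constant times the ratio for \<open>a + b\<close>, which integrates to 1.
  In particular shifts with disjoint supports have cross moment 1.\<close>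

lemma nn_integral_gauss_likelihood_mult:
  assumes "finite I" and "\<sigma> > 0"
  shows "(\<integral>\<^sup>+y. ennreal (gauss_likelihood \<sigma> I a y * gauss_likelihood \<sigma> I b y) \<partial>PiM I (\<lambda>i. gauss 0 \<sigma>))
    = ennreal (exp (\<Sum>i\<in>I. a i * b i / \<sigma>\<^sup>2))"
proof -
  have "gauss_likelihood \<sigma> I a y * gauss_likelihood \<sigma> I b y
      = exp (\<Sum>i\<in>I. a i * b i / \<sigma>\<^sup>2) * gauss_likelihood \<sigma> I (\<lambda>i. a i + b i) y" for y
  proof -
    have "(a i * y i - (a i)\<^sup>2 / 2) / \<sigma>\<^sup>2 + (b i * y i - (b i)\<^sup>2 / 2) / \<sigma>\<^sup>2
        = a i * b i / \<sigma>\<^sup>2 + ((a i + b i) * y i - (a i + b i)\<^sup>2 / 2) / \<sigma>\<^sup>2" for i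
      using assms by (simp add: field_simps power2_eq_square)
    then show ?thesis
      by (simp only: gauss_likelihood_def exp_add[symmetric] sum.distrib[symmetric])
  qed
  then show ?thesis
    using nn_integral_gauss_likelihood[OF assms, of "\<lambda>i. a i + b i"]
    by (simp add: ennreal_mult gauss_likelihood_nonneg nn_integral_cmult)
qed


section \<open>Testing the null hypothesis against a mixture\<close>

text \<open>Let R = S/c be the averaged ratio. As |X - b| is at least b - H, the sum of H and the
  average of \<open>\<rho> m y * \<bar>X m y - b\<bar>\<close> is pointwise at least b min(1, R).
  Its integral is at most 2 r, while that of b (R - R^2/4) is at least b/2. Everything is multiplied
  by c^2 to avoid divisions.\<close>

lemma mixture_lower_bound:
  fixes \<rho> X :: "'k \<Rightarrow> 'b \<Rightarrow> real" and b :: real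
  assumes "prob_space B" and K: "finite K" "K \<noteq> {}" and "b \<ge> 0"
    and \<rho> [measurable]: "\<And>m. m \<in> K \<Longrightarrow> \<rho> m \<in> borel_measurable B" and \<rho>0: "\<And>m y. m \<in> K \<Longrightarrow> 0 \<le> \<rho> m y"
    and \<rho>1: "\<And>m. m \<in> K \<Longrightarrow> (\<integral>\<^sup>+y. ennreal (\<rho> m y) \<partial>B) = 1"
    and \<rho>2: "(\<Sum>m\<in>K. \<Sum>m'\<in>K. \<integral>\<^sup>+y. ennreal (\<rho> m y * \<rho> m' y) \<partial>B) \<le> ennreal (2 * (real (card K))\<^sup>2)"
    and X [measurable]: "\<And>m. m \<in> K \<Longrightarrow> X m \<in> borel_measurable B"
    and r0: "(\<integral>\<^sup>+y. ennreal (MAX m\<in>K. \<bar>X m y\<bar>) \<partial>B) \<le> r"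
    and r1: "\<And>m. m \<in> K \<Longrightarrow> (\<integral>\<^sup>+y. ennreal (\<rho> m y * \<bar>X m y - b\<bar>) \<partial>B) \<le> r"
  shows "ennreal (b / 4) \<le> r"
proof -
  interpret prob_space B by fact
  define c where "c = real (card K)"
  have c: "c > 0" using K by (simp add: c_def card_gt_0_iff)
  define H where "H y = (MAX m\<in>K. \<bar>X m y\<bar>)" for y
  define S where "S y = (\<Sum>m\<in>K. \<rho> m y)" for y
  have Hm: "H \<in> borel_measurable B"
    unfolding H_def using K by (intro borel_measurable_Max) auto
  have S0: "S y \<ge> 0" for y using \<rho>0 by (auto simp: S_def intro: sum_nonneg)
  have H1: "\<bar>X m y\<bar> \<le> H y" if "m \<in> K" for m y
    unfolding H_def using K that by (intro Max_ge) auto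
  obtain m0 where m0: "m0 \<in> K" using K by auto
  have H0: "H y \<ge> 0" for y using H1[OF m0, of y] by linarith
  have point: "c * b * S y \<le> c\<^sup>2 * H y + c * (\<Sum>m\<in>K. \<rho> m y * \<bar>X m y - b\<bar>) + b / 4 * (S y)\<^sup>2" for y
  proof -
    have "S y * (b - H y) = (\<Sum>m\<in>K. \<rho> m y * (b - H y))" by (simp add: S_def sum_distrib_right)
    also have "\<dots> \<le> (\<Sum>m\<in>K. \<rho> m y * \<bar>X m y - b\<bar>)"
      using H1[of _ y] by (intro sum_mono mult_left_mono \<rho>0) fastforce+
    finally have 1: "S y * (b - H y) \<le> (\<Sum>m\<in>K. \<rho> m y * \<bar>X m y - b\<bar>)" .
    have nn: "(\<Sum>m\<in>K. \<rho> m y * \<bar>X m y - b\<bar>) \<ge> 0" using \<rho>0 by (auto intro: sum_nonneg)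
    \<comment> \<open>This is R - R^2/4 <= 1, with equality at R = 2.\<close>
    have "0 \<le> b / 4 * (S y - 2 * c)\<^sup>2" using \<open>b \<ge> 0\<close> by simp
    then have sq: "c * b * S y \<le> c\<^sup>2 * b + b / 4 * (S y)\<^sup>2"
      by (simp add: power2_eq_square algebra_simps)
    show ?thesis
    \<comment> \<open>In the first case b itself is bounded, which is trivial when H is at least b.
      In the other case R < 1 and H < b, so R H <= H and the square is dropped.\<close>
    proof (cases "c \<le> S y \<and> H y \<le> b \<or> b \<le> H y")
      case True
      have "c\<^sup>2 * b \<le> c\<^sup>2 * H y + c * (\<Sum>m\<in>K. \<rho> m y * \<bar>X m y - b\<bar>)"
      proof (cases "b \<le> H y")
        case True
        then show ?thesis using nn c mult_left_mono[OF True, of "c\<^sup>2"] by (simp add: add_increasing2)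
      next
        case False
        then have "c * (b - H y) \<le> S y * (b - H y)" using True by (intro mult_right_mono) auto
        with 1 have "c * (b - H y) \<le> (\<Sum>m\<in>K. \<rho> m y * \<bar>X m y - b\<bar>)" by linarith
        then have "c * (c * (b - H y)) \<le> c * (\<Sum>m\<in>K. \<rho> m y * \<bar>X m y - b\<bar>)" using c by simp
        then show ?thesis by (simp add: power2_eq_square algebra_simps)
      qed
      then show ?thesis using sq by linarith
    next
      case False
      then have "S y < c" by auto
      then have "c * H y * S y \<le> c * H y * c" using c H0 by (intro mult_left_mono) auto
      moreover have "c * (S y * (b - H y)) \<le> c * (\<Sum>m\<in>K. \<rho> m y * \<bar>X m y - b\<bar>)" using 1 c by simp
      moreover have "0 \<le> b / 4 * (S y)\<^sup>2" using \<open>b \<ge> 0\<close> by simp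
      ultimately show ?thesis by (simp add: power2_eq_square algebra_simps)
    qed
  qed
  have intS: "(\<integral>\<^sup>+y. ennreal (S y) \<partial>B) = ennreal c"
  proof -
    have "(\<integral>\<^sup>+y. ennreal (S y) \<partial>B) = (\<integral>\<^sup>+y. (\<Sum>m\<in>K. ennreal (\<rho> m y)) \<partial>B)"
      unfolding S_def using \<rho>0 by (simp add: sum_ennreal)
    also have "\<dots> = (\<Sum>m\<in>K. 1)" by (subst nn_integral_sum) (auto simp: \<rho>1)
    finally show ?thesis by (simp add: c_def ennreal_of_nat_eq_real_of_nat)
  qed
  have intS2: "(\<integral>\<^sup>+y. ennreal ((S y)\<^sup>2) \<partial>B) \<le> ennreal (2 * c\<^sup>2)"
  proof -
    have "ennreal ((S y)\<^sup>2) = (\<Sum>m\<in>K. \<Sum>m'\<in>K. ennreal (\<rho> m y * \<rho> m' y))" for y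
      unfolding S_def power2_eq_square sum_product
      using \<rho>0 by (simp add: sum_ennreal sum_nonneg)
    then have "(\<integral>\<^sup>+y. ennreal ((S y)\<^sup>2) \<partial>B) = (\<Sum>m\<in>K. \<Sum>m'\<in>K. \<integral>\<^sup>+y. ennreal (\<rho> m y * \<rho> m' y) \<partial>B)"
      by (simp add: nn_integral_sum)
    then show ?thesis using \<rho>2 by (simp add: c_def)
  qed
  have sum_r: "(\<integral>\<^sup>+y. (\<Sum>m\<in>K. ennreal (\<rho> m y * \<bar>X m y - b\<bar>)) \<partial>B) \<le> ennreal c * r"
  proof -
    have "(\<integral>\<^sup>+y. (\<Sum>m\<in>K. ennreal (\<rho> m y * \<bar>X m y - b\<bar>)) \<partial>B)
        = (\<Sum>m\<in>K. \<integral>\<^sup>+y. ennreal (\<rho> m y * \<bar>X m y - b\<bar>) \<partial>B)"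
      by (rule nn_integral_sum) measurable
    also have "\<dots> \<le> (\<Sum>m\<in>K. r)" by (intro sum_mono r1)
    finally show ?thesis by (simp add: c_def ennreal_of_nat_eq_real_of_nat)
  qed
  have [measurable]: "S \<in> borel_measurable B" unfolding S_def by measurable
  note Hm [measurable]
  have "ennreal (c * b) * ennreal c = (\<integral>\<^sup>+y. ennreal (c * b * S y) \<partial>B)"
    using \<open>b \<ge> 0\<close> c S0 by (simp add: ennreal_mult nn_integral_cmult intS)
  also have "\<dots> \<le> (\<integral>\<^sup>+y. ennreal (c\<^sup>2) * ennreal (H y)
      + (ennreal c * (\<Sum>m\<in>K. ennreal (\<rho> m y * \<bar>X m y - b\<bar>)) + ennreal (b / 4) * ennreal ((S y)\<^sup>2)) \<partial>B)"
  proof (rule nn_integral_mono)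
    fix y
    have "ennreal (c\<^sup>2) * ennreal (H y)
      + (ennreal c * (\<Sum>m\<in>K. ennreal (\<rho> m y * \<bar>X m y - b\<bar>)) + ennreal (b / 4) * ennreal ((S y)\<^sup>2))
      = ennreal (c\<^sup>2 * H y + c * (\<Sum>m\<in>K. \<rho> m y * \<bar>X m y - b\<bar>) + b / 4 * (S y)\<^sup>2)"
      using \<rho>0 c H0 \<open>b \<ge> 0\<close> by (simp add: sum_ennreal sum_nonneg ennreal_plus[symmetric] ennreal_mult[symmetric] add.assoc del: ennreal_plus)
    then show "ennreal (c * b * S y) \<le> ennreal (c\<^sup>2) * ennreal (H y)
      + (ennreal c * (\<Sum>m\<in>K. ennreal (\<rho> m y * \<bar>X m y - b\<bar>)) + ennreal (b / 4) * ennreal ((S y)\<^sup>2))"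
      using point[of y] by (simp add: ennreal_leI)
  qed
  also have "\<dots> = ennreal (c\<^sup>2) * (\<integral>\<^sup>+y. ennreal (H y) \<partial>B)
      + (ennreal c * (\<integral>\<^sup>+y. (\<Sum>m\<in>K. ennreal (\<rho> m y * \<bar>X m y - b\<bar>)) \<partial>B)
        + ennreal (b / 4) * (\<integral>\<^sup>+y. ennreal ((S y)\<^sup>2) \<partial>B))"
    by (simp add: nn_integral_add nn_integral_cmult)
  also have "\<dots> \<le> ennreal (c\<^sup>2) * r + (ennreal c * (ennreal c * r) + ennreal (b / 4) * ennreal (2 * c\<^sup>2))"
    using r0 sum_r intS2 by (intro add_mono mult_left_mono) (auto simp: H_def)
  finally have le: "ennreal (c * b) * ennreal c
      \<le> ennreal (c\<^sup>2) * r + (ennreal c * (ennreal c * r) + ennreal (b / 4) * ennreal (2 * c\<^sup>2))" .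
  \<comment> \<open>An infinite \<open>r\<close> is trivial. For finite \<open>r\<close> the
    inequality reads b <= 2 r + b/2 after division by c^2.\<close>
  show ?thesis
  proof (cases r)
    case (real x)
    have "ennreal (c * b * c) \<le> ennreal (c\<^sup>2 * x + c * (c * x) + b / 4 * (2 * c\<^sup>2))"
      using le real c \<open>b \<ge> 0\<close>
      by (simp add: ennreal_plus[symmetric] ennreal_mult[symmetric] add.assoc del: ennreal_plus)
    then have "c * b * c \<le> c\<^sup>2 * x + c * (c * x) + b / 4 * (2 * c\<^sup>2)"
      using real c \<open>b \<ge> 0\<close> by (subst (asm) ennreal_le_iff) auto
    then have "c\<^sup>2 * b \<le> c\<^sup>2 * (2 * x + b / 2)" by (simp add: power2_eq_square algebra_simps)
    then have "b \<le> 2 * x + b / 2" using c by simp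
    then show ?thesis using real by (simp add: ennreal_leI)
  qed simp
qed

lemma sup_norm_ge: "t \<in> cube \<Longrightarrow> ennreal \<bar>g t\<bar> \<le> sup_norm g"
  unfolding sup_norm_def by (rule SUP_upper)

text \<open>Upper bounds on risks of the form \<open>\<integral>\<^sup>+ \<dots> \<le> r\<close> are the hypotheses here because the sup-norm
  loss need not be measurable: only its values at the finitely many points \<open>t m\<close> are.\<close>

lemma sup_norm_risk_lower_bound:
  fixes \<mu> :: "'k \<Rightarrow> real ^ 'd::finite \<Rightarrow> real"
  assumes "prob_space B" and K: "finite K" "K \<noteq> {}" and "b \<ge> 0" and "V \<ge> 0"
    and \<rho> [measurable]: "\<And>m. m \<in> K \<Longrightarrow> \<rho> m \<in> borel_measurable B" and \<rho>0: "\<And>m y. m \<in> K \<Longrightarrow> 0 \<le> \<rho> m y"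
    and \<rho>1: "\<And>m. m \<in> K \<Longrightarrow> (\<integral>\<^sup>+y. ennreal (\<rho> m y) \<partial>B) = 1"
    and \<rho>2: "(\<Sum>m\<in>K. \<Sum>m'\<in>K. \<integral>\<^sup>+y. ennreal (\<rho> m y * \<rho> m' y) \<partial>B) \<le> ennreal (2 * (real (card K))\<^sup>2)"
    and G [measurable]: "G \<in> measurable B N"
    and h: "\<And>t. t \<in> cube \<Longrightarrow> (\<lambda>y. h y t) \<in> borel_measurable N"
    and t: "\<And>m. m \<in> K \<Longrightarrow> t m \<in> cube" and \<mu>: "\<And>m. m \<in> K \<Longrightarrow> \<mu> m (t m) = b"
    and r0: "(\<integral>\<^sup>+y. ennreal V * sup_norm (\<lambda>t. h y t - 0) \<partial>distr B N G) \<le> r"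
    and r1: "\<And>m. m \<in> K \<Longrightarrow>
      (\<integral>\<^sup>+y. ennreal V * sup_norm (\<lambda>t. h y t - \<mu> m t) \<partial>distr (density B (\<lambda>y. ennreal (\<rho> m y))) N G) \<le> r"
  shows "ennreal (V * b / 4) \<le> r"
\<comment> \<open>The factor V is moved into the test statistics, so the separation becomes V *
  b.\<close>
proof (rule mixture_lower_bound[where B = B and K = K and \<rho> = \<rho> and X = "\<lambda>m y. V * h (G y) (t m)"])
  note [measurable] = h[OF t]
  show "(\<lambda>y. V * h (G y) (t m)) \<in> borel_measurable B" if "m \<in> K" for m
    using that by measurable
  show "(\<integral>\<^sup>+y. ennreal (MAX m\<in>K. \<bar>V * h (G y) (t m)\<bar>) \<partial>B) \<le> r"
  proof -
    have [measurable]: "(\<lambda>y. MAX m\<in>K. \<bar>V * h y (t m)\<bar>) \<in> borel_measurable N"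
      using K by (intro borel_measurable_Max) auto
    have "(\<integral>\<^sup>+y. ennreal (MAX m\<in>K. \<bar>V * h (G y) (t m)\<bar>) \<partial>B)
        = (\<integral>\<^sup>+y. ennreal (MAX m\<in>K. \<bar>V * h y (t m)\<bar>) \<partial>distr B N G)"
      by (subst nn_integral_distr) auto
    also have "\<dots> \<le> (\<integral>\<^sup>+y. ennreal V * sup_norm (\<lambda>t. h y t - 0) \<partial>distr B N G)"
    proof (rule nn_integral_mono)
      fix y
      have "(MAX m\<in>K. \<bar>V * h y (t m)\<bar>) \<in> (\<lambda>m. \<bar>V * h y (t m)\<bar>) ` K" using K by (intro Max_in) auto
      then obtain m where m: "m \<in> K" "(MAX m\<in>K. \<bar>V * h y (t m)\<bar>) = \<bar>V * h y (t m)\<bar>" by auto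
      have "ennreal \<bar>V * h y (t m)\<bar> = ennreal V * ennreal \<bar>h y (t m) - 0\<bar>"
        using \<open>V \<ge> 0\<close> by (simp add: abs_mult ennreal_mult)
      also have "\<dots> \<le> ennreal V * sup_norm (\<lambda>t. h y t - 0)"
        using sup_norm_ge[OF t[OF m(1)], of "\<lambda>t. h y t - 0"] by (intro mult_left_mono) auto
      finally show "ennreal (MAX m\<in>K. \<bar>V * h y (t m)\<bar>) \<le> ennreal V * sup_norm (\<lambda>t. h y t - 0)"
        using m by simp
    qed
    finally show ?thesis using r0 by simp
  qed
  show "(\<integral>\<^sup>+y. ennreal (\<rho> m y * \<bar>V * h (G y) (t m) - V * b\<bar>) \<partial>B) \<le> r" if m: "m \<in> K" for m
  proof -
    note [measurable] = \<rho>[OF m] h[OF t[OF m]]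
    have "(\<integral>\<^sup>+y. ennreal (\<rho> m y * \<bar>V * h (G y) (t m) - V * b\<bar>) \<partial>B)
        = (\<integral>\<^sup>+y. ennreal \<bar>V * h y (t m) - V * b\<bar> \<partial>distr (density B (\<lambda>y. ennreal (\<rho> m y))) N G)"
      by (subst nn_integral_distr) (auto simp: nn_integral_density ennreal_mult \<rho>0[OF m])
    also have "\<dots> \<le> (\<integral>\<^sup>+y. ennreal V * sup_norm (\<lambda>t. h y t - \<mu> m t) \<partial>distr (density B (\<lambda>y. ennreal (\<rho> m y))) N G)"
    proof (rule nn_integral_mono)
      fix y
      have "\<bar>V * h y (t m) - V * b\<bar> = V * \<bar>h y (t m) - \<mu> m (t m)\<bar>"
        using \<open>V \<ge> 0\<close> \<mu>[OF m] by (simp add: abs_mult flip: right_diff_distrib)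
      then have "ennreal \<bar>V * h y (t m) - V * b\<bar> = ennreal V * ennreal \<bar>h y (t m) - \<mu> m (t m)\<bar>"
        using \<open>V \<ge> 0\<close> by (simp add: ennreal_mult)
      also have "\<dots> \<le> ennreal V * sup_norm (\<lambda>t. h y t - \<mu> m t)"
        using sup_norm_ge[OF t[OF m], of "\<lambda>t. h y t - \<mu> m t"] by (intro mult_left_mono) auto
      finally show "ennreal \<bar>V * h y (t m) - V * b\<bar> \<le> ennreal V * sup_norm (\<lambda>t. h y t - \<mu> m t)" .
    qed
    finally show ?thesis using r1[OF m] by simp
  qed
qed (use assms in auto)


section \<open>Bumps in Hoelder classes\<close>

text \<open>The Hoelder exponent \<alpha> - \<open>strict_floor \<alpha>\<close> thus lies in (0,
  1], the value 1 occurring for integer \<alpha>.\<close>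

lemma strict_floor_bounds:
  assumes "\<alpha> > 0"
  shows "real (strict_floor \<alpha>) < \<alpha>" and "\<alpha> \<le> real (strict_floor \<alpha>) + 1"
proof -
  obtain n where "\<alpha> < real n" using reals_Archimedean2 by blast
  then have "{k. real k < \<alpha>} \<subseteq> {..n}" by auto
  then have fin: "finite {k. real k < \<alpha>}" by (rule finite_subset) simp
  have "strict_floor \<alpha> \<in> {k. real k < \<alpha>}"
    unfolding strict_floor_def by (rule Max_in) (use fin assms in \<open>auto intro!: exI[of _ 0]\<close>)
  then show "real (strict_floor \<alpha>) < \<alpha>" by simp
  show "\<alpha> \<le> real (strict_floor \<alpha>) + 1"
  proof (rule ccontr)
    assume "\<not> \<alpha> \<le> real (strict_floor \<alpha>) + 1"
    then have "Suc (strict_floor \<alpha>) \<in> {k. real k < \<alpha>}" by simp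
    then have "Suc (strict_floor \<alpha>) \<le> strict_floor \<alpha>"
      unfolding strict_floor_def using fin by (intro Max_ge) auto
    then show False by simp
  qed
qed

section \<open>Smooth bumps with compact support\<close>

text \<open>The \<open>b\<close>-th derivative of \<open>u \<mapsto> (1 - u\<^sup>2)\<^sub>+ ^ N\<close>, provided that \<open>b < N\<close>.\<close>

definition bump_deriv :: "nat \<Rightarrow> nat \<Rightarrow> real \<Rightarrow> real" where
  "bump_deriv N b u = (if \<bar>u\<bar> \<le> 1 then poly ((pderiv ^^ b) ([:1, 0, -1:] ^ N)) u else 0)"

text \<open>Each differentiation lowers the multiplicity of the factor \<open>q\<close> by at most
  one.\<close>

lemma dvd_higher_pderiv_power:
  fixes q :: "real poly"
  shows "b \<le> N \<Longrightarrow> q ^ (N - b) dvd (pderiv ^^ b) (q ^ N)"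
proof (induction b)
  case (Suc b)
  then have "q ^ (N - b) dvd (pderiv ^^ b) (q ^ N)" by simp
  moreover have "N - b = Suc (N - Suc b)" using Suc.prems by simp
  ultimately obtain r where "(pderiv ^^ b) (q ^ N) = q ^ Suc (N - Suc b) * r" by (metis dvdE)
  moreover define j where "j = N - Suc b"
  ultimately have "(pderiv ^^ Suc b) (q ^ N) = pderiv (q ^ Suc j * r)" by simp
  also have "\<dots> = q ^ Suc j * pderiv r + r * (smult (of_nat (Suc j)) (q ^ j) * pderiv q)"
    by (simp only: pderiv_mult pderiv_power_Suc)
  finally show ?case unfolding j_def[symmetric]
    by (metis dvd_add dvd_mult dvd_mult2 dvd_smult dvd_refl power_Suc)
qed simp

lemma poly_bump_deriv_boundary:
  assumes "b < N" and "\<bar>u\<bar> = 1"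
  shows "poly ((pderiv ^^ b) ([:1, 0, -1:] ^ N)) (u::real) = 0"
proof -
  have "([:1, 0, -1:] :: real poly) ^ (N - b) dvd (pderiv ^^ b) ([:1, 0, -1:] ^ N)"
    using assms by (intro dvd_higher_pderiv_power) simp
  then have "poly ([:1, 0, -1:] ^ (N - b)) u dvd poly ((pderiv ^^ b) ([:1, 0, -1:] ^ N)) u"
    by (auto elim!: dvdE)
  moreover have "u * u = 1" using assms(2) by (auto simp: abs_if split: if_splits)
  ultimately show ?thesis using assms(1) by (simp add: power_0_left)
qed

lemma bump_deriv_eq_0: "b < N \<Longrightarrow> \<bar>u\<bar> \<ge> 1 \<Longrightarrow> bump_deriv N b u = 0"
  using poly_bump_deriv_boundary[of b N u] by (cases "\<bar>u\<bar> = 1") (auto simp: bump_deriv_def)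

text \<open>Only |u| = 1 needs an argument. There the polynomial and its derivative both vanish,
  because \<open>b\<close> and \<open>Suc b\<close> are below the multiplicity N, and cutting off
  the outside can only shrink the difference quotient.\<close>

lemma has_real_derivative_bump_deriv:
  assumes "Suc b < N"
  shows "(bump_deriv N b has_real_derivative bump_deriv N (Suc b) u) (at u)"
proof -
  define p where "p = (pderiv ^^ b) ([:1, 0, -1:] ^ N :: real poly)"
  have p': "(poly p has_real_derivative poly (pderiv p) u) (at u)" for u by simp
  have f: "bump_deriv N b = (\<lambda>u. if \<bar>u\<bar> \<le> 1 then poly p u else 0)"
    by (simp add: bump_deriv_def p_def fun_eq_iff)
  have f': "bump_deriv N (Suc b) u = (if \<bar>u\<bar> \<le> 1 then poly (pderiv p) u else 0)"
    by (simp add: bump_deriv_def p_def)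
  consider "\<bar>u\<bar> < 1" | "\<bar>u\<bar> > 1" | "\<bar>u\<bar> = 1" by linarith
  then show ?thesis
  proof cases
    case 1
    have "open {v::real. \<bar>v\<bar> < 1}" by (intro open_Collect_less continuous_intros)
    then have "(bump_deriv N b has_real_derivative poly (pderiv p) u) (at u)"
      by (rule has_field_derivative_transform_within_open[OF p']) (use 1 in \<open>auto simp: f\<close>)
    then show ?thesis using 1 f' by simp
  next
    case 2
    have "open {v::real. \<bar>v\<bar> > 1}" by (intro open_Collect_less continuous_intros)
    then have "(bump_deriv N b has_real_derivative 0) (at u)"
      by (rule has_field_derivative_transform_within_open[OF DERIV_const[of 0]]) (use 2 in \<open>auto simp: f\<close>)
    then show ?thesis using 2 f' by simp
  next
    case 3
    have p0: "poly p u = 0" unfolding p_def using assms 3 by (intro poly_bump_deriv_boundary) auto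
    have "poly ((pderiv ^^ Suc b) ([:1, 0, -1:] ^ N)) u = 0"
      using assms 3 by (intro poly_bump_deriv_boundary) auto
    then have p'0: "poly (pderiv p) u = 0" by (simp add: p_def)
    have "((\<lambda>v. (bump_deriv N b v - bump_deriv N b u) / (v - u)) \<longlongrightarrow> 0) (at u)"
    proof (rule Lim_null_comparison)
      show "\<forall>\<^sub>F v in at u. norm ((bump_deriv N b v - bump_deriv N b u) / (v - u))
          \<le> norm ((poly p v - poly p u) / (v - u))"
        using 3 p0 by (auto simp: f)
      show "((\<lambda>v. norm ((poly p v - poly p u) / (v - u))) \<longlongrightarrow> 0) (at u)"
        using p'[of u] p'0 unfolding has_field_derivative_iff by (intro tendsto_norm_zero) simp
    qed
    then show ?thesis using 3 f' p'0 by (simp add: has_field_derivative_iff)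
  qed
qed

lemma bump_deriv_bounded: "\<exists>C\<ge>1. \<forall>b\<le>M. \<forall>u. \<bar>bump_deriv N b u\<bar> \<le> C"
proof -
  have "\<exists>C. \<forall>u. \<bar>bump_deriv N b u\<bar> \<le> C" for b
  proof -
    let ?p = "(pderiv ^^ b) ([:1, 0, -1:] ^ N) :: real poly"
    have "bounded (poly ?p ` {-1..1})"
      by (intro compact_imp_bounded compact_continuous_image continuous_intros) auto
    then obtain C where "\<forall>u\<in>{-1..1}. \<bar>poly ?p u\<bar> \<le> C" by (auto simp: bounded_iff)
    then have "\<bar>bump_deriv N b u\<bar> \<le> \<bar>C\<bar>" for u by (force simp: bump_deriv_def abs_le_iff)
    then show ?thesis by blast
  qed
  then obtain C where C: "\<And>b u. \<bar>bump_deriv N b u\<bar> \<le> C b" by metis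
  have "C b \<le> 1 + (\<Sum>b\<le>M. \<bar>C b\<bar>)" if "b \<le> M" for b
  proof -
    have "\<bar>C b\<bar> \<le> (\<Sum>b\<le>M. \<bar>C b\<bar>)" using that by (intro member_le_sum) auto
    then show ?thesis by linarith
  qed
  then have "\<forall>b\<le>M. \<forall>u. \<bar>bump_deriv N b u\<bar> \<le> 1 + (\<Sum>b\<le>M. \<bar>C b\<bar>)" using C order_trans by blast
  moreover have "1 \<le> 1 + (\<Sum>b\<le>M. \<bar>C b\<bar>)" by (simp add: sum_nonneg)
  ultimately show ?thesis by blast
qed

text \<open>The bump is A h^\<alpha> times the product over the coordinates of a fixed profile at
  (x_i - t)/h. Each derivative costs a factor 1/h, which h^\<alpha> compensates up to the order of
  the Hoelder class, so A can be chosen before t and h.\<close>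

lemma ex_hoelder_bump:
  assumes "\<alpha> > 0" and "L > 0"
  shows "\<exists>A>0. \<forall>t h. 0 < h \<longrightarrow> h \<le> 1 \<longrightarrow> (\<exists>g\<in>(hoelder_class \<alpha> L :: (real ^ 'd::finite \<Rightarrow> real) set).
    g (vec t) = A * h powr \<alpha> \<and> (\<forall>x. \<bar>g x\<bar> \<le> A * h powr \<alpha>) \<and>
    (\<forall>x i. h \<le> \<bar>x $ i - t\<bar> \<longrightarrow> g x = 0))"
proof -
  define m where "m = strict_floor \<alpha>"
  define d where "d = CARD('d)"
  have m: "real m < \<alpha>" "\<alpha> \<le> real m + 1"
    using strict_floor_bounds[OF \<open>\<alpha> > 0\<close>] by (auto simp: m_def)
  \<comment> \<open>The power m + 2 makes the derivatives of order up to m differentiable with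
    bounded derivatives, hence Lipschitz.\<close>
  define \<psi> where "\<psi> = bump_deriv (m + 2)"
  obtain C where "C \<ge> 1" and C: "\<And>b u. b \<le> Suc m \<Longrightarrow> \<bar>\<psi> b u\<bar> \<le> C"
    using bump_deriv_bounded[of "Suc m" "m + 2"] unfolding \<psi>_def by blast
  have \<psi>': "(\<psi> b has_real_derivative \<psi> (Suc b) u) (at u)" if "b \<le> m" for b u
    unfolding \<psi>_def using that by (intro has_real_derivative_bump_deriv) simp
  have lip: "\<bar>\<psi> b u - \<psi> b v\<bar> \<le> C * \<bar>u - v\<bar>" if "b \<le> m" for b u v
    using field_differentiable_bound[of UNIV "\<psi> b" "\<psi> (Suc b)" C u v] \<psi>'[OF that] C that by auto
  \<comment> \<open>Each of the two suprema in the Hoelder norm gets L/2. The factor d + 2 covers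
    both constants in \<open>P_diff\<close>: d for close points and 2 for distant ones.\<close>
  define A where "A = L / (2 * (real d + 2) * C ^ d)"
  have "A > 0" using \<open>L > 0\<close> \<open>C \<ge> 1\<close> by (simp add: A_def)
  show ?thesis
  proof (intro exI[of _ A] conjI allI impI \<open>A > 0\<close>)
    fix t h :: real assume "0 < h" "h \<le> 1"
    define P where "P \<beta> x = (\<Prod>i\<in>UNIV. \<psi> (\<beta> i) ((x $ i - t) / h))" for \<beta> and x :: "real ^ 'd"
    define D where "D \<beta> x = A * h powr (\<alpha> - real (mi_order \<beta>)) * P \<beta> x" for \<beta> :: "'d \<Rightarrow> nat" and x
    have comp: "\<beta> i \<le> mi_order \<beta>" for \<beta> :: "'d \<Rightarrow> nat" and i
      unfolding mi_order_def by (rule member_le_sum) auto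
    have P_le: "\<bar>P \<beta> x\<bar> \<le> C ^ d" if "mi_order \<beta> \<le> m" for \<beta> x
    proof -
      have "\<bar>P \<beta> x\<bar> = (\<Prod>i\<in>UNIV. \<bar>\<psi> (\<beta> i) ((x $ i - t) / h)\<bar>)" unfolding P_def by (rule abs_prod)
      also have "\<dots> \<le> (\<Prod>i\<in>(UNIV::'d set). C)"
        using comp[of \<beta>] that by (intro prod_mono conjI C) (auto intro: order_trans le_SucI)
      finally show ?thesis by (simp add: d_def)
    qed
    have P_diff: "\<bar>P \<beta> x - P \<beta> y\<bar> \<le> (real d + 2) * C ^ d * (infnorm (x - y) / h) powr (\<alpha> - real m)"
      if "mi_order \<beta> \<le> m" "x \<noteq> y" for \<beta> x y
    proof -
      define s where "s = infnorm (x - y) / h"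
      have "s > 0" using \<open>0 < h\<close> that by (simp add: s_def infnorm_pos_lt)
      have \<beta>: "\<beta> i \<le> m" for i using comp[of \<beta> i] that by simp
      show ?thesis
      \<comment> \<open>For s <= 1 the Lipschitz bound suffices, since s <= s^(\<alpha>-m) for an
        exponent of at most 1. For s > 1 that power is at least 1 and twice the sup bound
        suffices.\<close>
      proof (cases "s \<le> 1")
        case True
        \<comment> \<open>Division by C brings all factors into the unit ball, where products differ
          by at most the sum of the differences of their factors.\<close>
        let ?a = "\<lambda>x i. \<psi> (\<beta> i) ((x $ i - t) / h) / C"
        have "\<bar>(\<Prod>i\<in>UNIV. ?a x i) - (\<Prod>i\<in>UNIV. ?a y i)\<bar> \<le> (\<Sum>i\<in>UNIV. \<bar>?a x i - ?a y i\<bar>)"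
          using norm_prod_diff[of UNIV "?a x" "?a y"] C \<beta> \<open>C \<ge> 1\<close> by (simp add: le_SucI)
        also have "\<dots> \<le> (\<Sum>i\<in>(UNIV::'d set). s)"
        proof (rule sum_mono)
          fix i
          have "\<bar>?a x i - ?a y i\<bar> = \<bar>\<psi> (\<beta> i) ((x $ i - t) / h) - \<psi> (\<beta> i) ((y $ i - t) / h)\<bar> / C"
            using \<open>C \<ge> 1\<close> by (simp flip: diff_divide_distrib)
          also have "\<dots> \<le> C * \<bar>(x $ i - t) / h - (y $ i - t) / h\<bar> / C"
            using \<open>C \<ge> 1\<close> by (intro divide_right_mono lip \<beta>) auto
          also have "\<dots> = \<bar>(x - y) $ i\<bar> / h"
            using \<open>C \<ge> 1\<close> \<open>0 < h\<close> by (simp flip: diff_divide_distrib)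
          also have "\<dots> \<le> s"
            unfolding s_def using \<open>0 < h\<close> component_le_infnorm_cart[of "x - y" i]
            by (intro divide_right_mono) auto
          finally show "\<bar>?a x i - ?a y i\<bar> \<le> s" .
        qed
        finally have "\<bar>P \<beta> x / C ^ d - P \<beta> y / C ^ d\<bar> \<le> real d * s"
          by (simp add: P_def d_def prod_dividef)
        then have "\<bar>P \<beta> x - P \<beta> y\<bar> / C ^ d \<le> real d * s"
          using \<open>C \<ge> 1\<close> by (simp flip: diff_divide_distrib)
        then have "\<bar>P \<beta> x - P \<beta> y\<bar> \<le> C ^ d * (real d * s)"
          using \<open>C \<ge> 1\<close> by (simp add: field_simps)
        also have "\<dots> \<le> C ^ d * ((real d + 2) * s powr (\<alpha> - real m))"
        proof (intro mult_left_mono mult_mono)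
          have "s powr 1 \<le> s powr (\<alpha> - real m)"
            using m True \<open>s > 0\<close> by (intro powr_mono') auto
          then show "s \<le> s powr (\<alpha> - real m)" using \<open>s > 0\<close> by simp
        qed (use \<open>C \<ge> 1\<close> \<open>s > 0\<close> in auto)
        finally show ?thesis by (simp add: s_def mult_ac)
      next
        case False
        have "\<bar>P \<beta> x - P \<beta> y\<bar> \<le> 2 * C ^ d"
          using P_le[OF that(1), of x] P_le[OF that(1), of y] by linarith
        also have "\<dots> \<le> (real d + 2) * C ^ d * s powr (\<alpha> - real m)"
        proof -
          have "1 \<le> s powr (\<alpha> - real m)" using False m by (intro ge_one_powr_ge_zero) auto
          moreover have "2 * C ^ d \<le> (real d + 2) * C ^ d" using \<open>C \<ge> 1\<close> by (intro mult_right_mono) auto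
          moreover have "0 \<le> (real d + 2) * C ^ d" using \<open>C \<ge> 1\<close> by simp
          ultimately show ?thesis by (metis mult.right_neutral mult_left_mono order_trans)
        qed
        finally show ?thesis by (simp add: s_def)
      qed
    qed
    have "partial_derivs m (D (\<lambda>_. 0)) D"
      unfolding partial_derivs_def
    proof (intro conjI ballI allI impI)
      fix \<beta> :: "'d \<Rightarrow> nat" and k and x :: "real ^ 'd"
      assume "mi_order \<beta> < m" "x \<in> cube"
      then have \<beta>k: "\<beta> k \<le> m" using comp[of \<beta> k] by simp
      define R where "R = (\<Prod>i\<in>UNIV - {k}. \<psi> (\<beta> i) ((x $ i - t) / h))"
      have order: "mi_order (\<beta>(k := Suc (\<beta> k))) = Suc (mi_order \<beta>)"
        unfolding mi_order_def by (simp add: sum.remove[of UNIV k])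
      have eq1: "D \<beta> (\<chi> i. if i = k then s else x $ i)
          = A * h powr (\<alpha> - real (mi_order \<beta>)) * (\<psi> (\<beta> k) ((s - t) / h) * R)" for s
        unfolding D_def P_def R_def by (simp add: prod.remove[of UNIV k])
      have eq2: "D (\<beta>(k := Suc (\<beta> k))) x
          = A * h powr (\<alpha> - real (mi_order \<beta>)) * (\<psi> (Suc (\<beta> k)) ((x $ k - t) / h) * (1 / h) * R)"
      proof -
        have "P (\<beta>(k := Suc (\<beta> k))) x = \<psi> (Suc (\<beta> k)) ((x $ k - t) / h) * R"
          unfolding P_def R_def by (simp add: prod.remove[of UNIV k])
        moreover have "h powr (\<alpha> - real (mi_order (\<beta>(k := Suc (\<beta> k))))) = h powr (\<alpha> - real (mi_order \<beta>)) / h"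
        proof -
          have "\<alpha> - real (Suc (mi_order \<beta>)) = \<alpha> - real (mi_order \<beta>) - 1" by simp
          then show ?thesis unfolding order using \<open>0 < h\<close> by (metis powr_diff powr_one less_imp_le)
        qed
        ultimately show ?thesis by (simp add: D_def)
      qed
      have "((\<lambda>s. \<psi> (\<beta> k) ((s - t) / h)) has_real_derivative \<psi> (Suc (\<beta> k)) ((x $ k - t) / h) * (1 / h)) (at (x $ k))"
        by (rule DERIV_chain2[OF \<psi>'[OF \<beta>k]]) (use \<open>0 < h\<close> in \<open>auto intro!: derivative_eq_intros\<close>)
      then have "((\<lambda>s. D \<beta> (\<chi> i. if i = k then s else x $ i)) has_real_derivative
          D (\<beta>(k := Suc (\<beta> k))) x) (at (x $ k))"
        unfolding eq1 eq2 by (intro DERIV_cmult DERIV_cmult_right)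
      then show "((\<lambda>s. D \<beta> (\<chi> i. if i = k then s else x $ i)) has_real_derivative
          D (\<beta>(k := Suc (\<beta> k))) x) (at (x $ k) within {0..1})"
        by (rule has_field_derivative_at_within)
    qed simp
    moreover have "hoelder_norm \<alpha> D \<le> ennreal L"
    proof -
      have "C ^ d \<noteq> 0" using \<open>C \<ge> 1\<close> by simp
      then have "A * C ^ d = L / (2 * (real d + 2))" by (simp add: A_def)
      then have AC: "A * C ^ d * (real d + 2) = L / 2" by (simp add: field_simps)
      have "\<bar>D \<beta> x\<bar> \<le> L / 2" if "mi_order \<beta> \<le> m" for \<beta> x
      proof -
        have "\<bar>D \<beta> x\<bar> = A * h powr (\<alpha> - real (mi_order \<beta>)) * \<bar>P \<beta> x\<bar>"
          using \<open>A > 0\<close> by (simp add: D_def abs_mult)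
        also have "\<dots> \<le> A * 1 * C ^ d"
          using \<open>A > 0\<close> \<open>0 < h\<close> \<open>h \<le> 1\<close> m that P_le[OF that, of x]
          by (intro mult_mono powr_le1) auto
        also have "\<dots> \<le> A * C ^ d * (real d + 2)" using \<open>A > 0\<close> \<open>C \<ge> 1\<close> by simp
        finally show ?thesis using AC by simp
      qed
      then have "(SUP \<beta>\<in>{\<beta>. mi_order \<beta> \<le> m}. sup_norm (D \<beta>)) \<le> ennreal (L / 2)"
        unfolding sup_norm_def by (intro SUP_least ennreal_leI) auto
      moreover have "\<bar>D \<beta> x - D \<beta> y\<bar> / infnorm (x - y) powr (\<alpha> - real m) \<le> L / 2"
        if "mi_order \<beta> = m" "x \<noteq> y" for \<beta> x y
      proof -
        have pos: "infnorm (x - y) > 0" using that by (simp add: infnorm_pos_lt)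
        have "\<bar>D \<beta> x - D \<beta> y\<bar> = A * h powr (\<alpha> - real m) * \<bar>P \<beta> x - P \<beta> y\<bar>"
          using \<open>A > 0\<close> that by (simp add: D_def abs_mult flip: right_diff_distrib)
        also have "\<dots> \<le> A * h powr (\<alpha> - real m)
            * ((real d + 2) * C ^ d * (infnorm (x - y) / h) powr (\<alpha> - real m))"
          using \<open>A > 0\<close> that by (intro mult_left_mono P_diff) auto
        \<comment> \<open>The powers of h cancel at order m.\<close>
        also have "\<dots> = L / 2 * infnorm (x - y) powr (\<alpha> - real m)"
          unfolding AC[symmetric] using \<open>0 < h\<close> pos by (simp add: powr_divide)
        finally show ?thesis using pos by (simp add: divide_le_eq)
      qed
      then have "(SUP \<beta>\<in>{\<beta>. mi_order \<beta> = m}. SUP (x, y)\<in>{(x, y). x \<in> cube \<and> y \<in> cube \<and> x \<noteq> y}.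
          ennreal (\<bar>D \<beta> x - D \<beta> y\<bar> / infnorm (x - y) powr (\<alpha> - real m))) \<le> ennreal (L / 2)"
        by (intro SUP_least) (auto intro!: SUP_least ennreal_leI)
      ultimately have "hoelder_norm \<alpha> D \<le> ennreal (L / 2) + ennreal (L / 2)"
        unfolding hoelder_norm_def m_def[symmetric] by (rule add_mono)
      then show ?thesis using \<open>L > 0\<close> by (simp flip: ennreal_plus)
    qed
    ultimately have "D (\<lambda>_. 0) \<in> hoelder_class \<alpha> L"
      unfolding hoelder_class_def m_def by blast
    moreover have D0: "D (\<lambda>_. 0) x = A * h powr \<alpha> * (\<Prod>i\<in>UNIV. \<psi> 0 ((x $ i - t) / h))" for x
      by (simp add: D_def P_def mi_order_def)
    have "D (\<lambda>_. 0) (vec t) = A * h powr \<alpha>"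
      unfolding D0 by (simp add: \<psi>_def bump_deriv_def)
    moreover have "\<bar>D (\<lambda>_. 0) x\<bar> \<le> A * h powr \<alpha>" for x
    proof -
      have "\<bar>\<psi> 0 u\<bar> \<le> 1" for u
      proof (cases "\<bar>u\<bar> \<le> 1")
        case True
        then have "u * u \<le> 1" by (metis abs_le_square_iff abs_one one_power2 power2_eq_square)
        then have "\<bar>1 - u * u\<bar> \<le> 1" by simp
        then have "\<bar>1 - u * u\<bar> ^ (m + 2) \<le> 1" by (intro power_le_one) auto
        moreover have "\<psi> 0 u = (1 - u * u) ^ (m + 2)"
          using True by (simp add: \<psi>_def bump_deriv_def algebra_simps)
        ultimately show ?thesis by (simp only: power_abs)
      qed (simp add: \<psi>_def bump_deriv_def)
      then have "(\<Prod>i\<in>UNIV. \<bar>\<psi> 0 ((x $ i - t) / h)\<bar>) \<le> 1" by (intro prod_le_1) auto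
      then show ?thesis
        unfolding D0 using \<open>A > 0\<close> by (simp add: abs_mult abs_prod mult_left_le)
    qed
    moreover have "D (\<lambda>_. 0) x = 0" if "h \<le> \<bar>x $ i - t\<bar>" for x i
    proof -
      have "\<psi> 0 ((x $ i - t) / h) = 0"
        unfolding \<psi>_def using that \<open>0 < h\<close> by (intro bump_deriv_eq_0) auto
      then show ?thesis unfolding D0 by auto
    qed
    ultimately show "\<exists>g\<in>(hoelder_class \<alpha> L :: (real ^ 'd \<Rightarrow> real) set).
      g (vec t) = A * h powr \<alpha> \<and> (\<forall>x. \<bar>g x\<bar> \<le> A * h powr \<alpha>) \<and>
      (\<forall>x i. h \<le> \<bar>x $ i - t\<bar> \<longrightarrow> g x = 0)" by blast
  qed
qed

lemma const_in_hoelder_class: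
  assumes "\<bar>c\<bar> \<le> L"
  shows "(\<lambda>_. c) \<in> (hoelder_class \<alpha> L :: (real ^ 'd::finite \<Rightarrow> real) set)"
proof -
  define D :: "('d \<Rightarrow> nat) \<Rightarrow> real ^ 'd \<Rightarrow> real" where "D \<beta> x = (if \<beta> = (\<lambda>_. 0) then c else 0)" for \<beta> x
  have "\<beta>(k := Suc (\<beta> k)) \<noteq> (\<lambda>_. 0)" for \<beta> and k :: 'd
    by (auto simp: fun_eq_iff)
  then have "partial_derivs m (\<lambda>_. c) D" for m
    by (auto simp: partial_derivs_def D_def)
  moreover have "hoelder_norm \<alpha> D \<le> ennreal L + 0"
    unfolding hoelder_norm_def sup_norm_def
    by (intro add_mono SUP_least) (use assms in \<open>auto simp: D_def intro!: ennreal_leI\<close>)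
  ultimately show ?thesis by (auto simp: hoelder_class_def)
qed


section \<open>Spacing of the design points\<close>

text \<open>The density has mass |l - l'|/m between the two design points, and with height at most F
  this mass needs length at least |l - l'|/(m F).\<close>

lemma generated_design_separation:
  assumes "generated_design f x" and f: "\<And>t. t \<in> {0..1} \<Longrightarrow> 0 \<le> f k t \<and> f k t \<le> F"
    and "l \<in> {1..m}" and "l' \<in> {1..m}"
  shows "\<bar>real l - real l'\<bar> / real m \<le> F * \<bar>x k m l - x k m l'\<bar>"
proof -
  have *: "\<bar>real l - real l'\<bar> / real m \<le> F * \<bar>x k m l - x k m l'\<bar>"
    if "l \<in> {1..m}" "l' \<in> {1..m}" and le: "x k m l \<le> x k m l'" for l l'
  proof -
    let ?a = "x k m l" and ?b = "x k m l'"
    have a: "?a \<in> {0..1}" "(f k has_integral (real l - 1/2) / real m) {0..?a}"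
      and b: "?b \<in> {0..1}" "(f k has_integral (real l' - 1/2) / real m) {0..?b}"
      using assms(1) that unfolding generated_design_def by auto
    have "f k integrable_on {?a..?b}"
      using b a le by (intro integrable_on_subinterval[OF has_integral_integrable[OF b(2)]]) auto
    then obtain I where I: "(f k has_integral I) {?a..?b}" by blast
    have "(f k has_integral (real l - 1/2) / real m + I) {0..?b}"
      using a le by (intro has_integral_combine[OF _ _ a(2) I]) auto
    then have "I = (real l' - 1/2) / real m - (real l - 1/2) / real m"
      using has_integral_unique[OF b(2)] by fastforce
    also have "\<dots> = (real l' - real l) / real m" by (simp flip: diff_divide_distrib)
    finally have I_eq: "I = (real l' - real l) / real m" .
    have sub: "{?a..?b} \<subseteq> {0..1}" using a b by auto
    have "0 \<le> I" using f sub by (intro has_integral_nonneg[OF I]) auto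
    have "((\<lambda>_. F) has_integral F * (?b - ?a)) {?a..?b}"
      using has_integral_const_real[of F ?a ?b] le by (simp add: mult.commute)
    then have "I \<le> F * (?b - ?a)" using f sub by (intro has_integral_le[OF I]) auto
    moreover have "\<bar>real l - real l'\<bar> / real m = I"
    proof -
      have "m > 0" using that by auto
      \<comment> \<open>The order of the indices is read off from the sign of the mass between the
        points.\<close>
      then have "real l \<le> real l'" using \<open>0 \<le> I\<close> by (auto simp: I_eq zero_le_divide_iff)
      then show ?thesis by (simp add: I_eq)
    qed
    ultimately show ?thesis using le by simp
  qed
  show ?thesis
  proof (cases "x k m l \<le> x k m l'")
    case True
    then show ?thesis using * assms by blast
  next
    case False
    then show ?thesis using *[of l' l] assms by (simp add: abs_minus_commute)
  qed
qed

lemma card_le_diameter: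
  fixes S :: "nat set"
  assumes "finite S" and "D \<ge> 0" and "\<And>a b. a \<in> S \<Longrightarrow> b \<in> S \<Longrightarrow> real b - real a \<le> D"
  shows "real (card S) \<le> D + 1"
proof (cases "S = {}")
  case False
  have "S \<subseteq> {Min S..Max S}" using assms(1) by auto
  then have "card S \<le> card {Min S..Max S}" by (rule card_mono[rotated]) simp
  moreover have "Min S \<le> Max S" using False assms(1) by simp
  moreover have "real (Max S) - real (Min S) \<le> D" using False assms by (intro assms(3)) auto
  ultimately show ?thesis by (simp add: Suc_diff_le)
qed (use assms in auto)

lemma finite_obs_index: "finite (obs_index n (p :: 'd::finite \<Rightarrow> nat))"
proof -
  have "{j. \<forall>k. 1 \<le> j k \<and> j k \<le> p k} = (\<Pi>\<^sub>E k\<in>UNIV. {1..p k})" by (auto simp: PiE_iff)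
  then show ?thesis unfolding obs_index_def by (simp add: finite_PiE)
qed

text \<open>One bound for the densities of all coordinates. With F >= 1 the gap radius 1/(2 F m) is
  at most 1/2, so a gap fits into [0,1] on one side of a design point.\<close>

locale bounded_design =
  fixes f :: "'d::finite \<Rightarrow> real \<Rightarrow> real" and x :: "'d \<Rightarrow> nat \<Rightarrow> nat \<Rightarrow> real" and F :: real
  assumes design: "generated_design f x"
    and density_bounds: "\<And>k t. t \<in> {0..1} \<Longrightarrow> 0 \<le> f k t \<and> f k t \<le> F"
    and F_ge_1: "F \<ge> 1"
begin

lemma separation:
  "l \<in> {1..m} \<Longrightarrow> l' \<in> {1..m} \<Longrightarrow> \<bar>real l - real l'\<bar> \<le> F * real m * \<bar>x k m l - x k m l'\<bar>"
  using generated_design_separation[OF design density_bounds, of l m l' k]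
  by (cases "m = 0") (simp_all add: pos_divide_le_eq mult.commute mult.left_commute)

text \<open>By \<open>separation\<close> the indices found in a window of length 2h span at most 2 F
  m h.\<close>

lemma card_design_interval:
  assumes "h > 0"
  shows "real (card {l\<in>{1..m}. \<bar>x k m l - t\<bar> < h}) \<le> 2 * F * real m * h + 1"
proof (rule card_le_diameter)
  fix a b assume ab: "a \<in> {l\<in>{1..m}. \<bar>x k m l - t\<bar> < h}" "b \<in> {l\<in>{1..m}. \<bar>x k m l - t\<bar> < h}"
  then have "\<bar>real b - real a\<bar> \<le> F * real m * \<bar>x k m b - x k m a\<bar>" by (intro separation) auto
  also have "\<dots> \<le> F * real m * (2 * h)" using ab F_ge_1 by (intro mult_left_mono) auto
  finally show "real b - real a \<le> 2 * F * real m * h" by (simp add: mult_ac)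
qed (use assms F_ge_1 in auto)

text \<open>Distinct design points are at least 1/(F m) = 2h apart. A point t at distance h from the
  first one is therefore at distance at least h from all others. It is placed on the side of the
  first point that has room in [0,1].\<close>

lemma ex_design_gap:
  assumes "m \<ge> 1"
  shows "\<exists>t\<in>{0..1}. \<forall>l\<in>{1..m}. 1 / (2 * F * real m) \<le> \<bar>x k m l - t\<bar>"
proof -
  define h where "h = 1 / (2 * F * real m)"
  have Fm: "F * real m \<ge> 1"
    using mult_mono[of 1 F 1 "real m"] assms F_ge_1 by simp
  have h_eq: "F * real m * h = 1 / 2" using F_ge_1 assms by (simp add: h_def)
  have "0 < h" using assms F_ge_1 by (simp add: h_def)
  moreover have "1 * h \<le> F * real m * h" using Fm \<open>0 < h\<close> by (intro mult_right_mono) auto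
  ultimately have h: "0 < h" "h \<le> 1 / 2" using h_eq by auto
  have x1: "x k m 1 \<in> {0..1}" using design assms by (auto simp: generated_design_def)
  obtain t where t: "t \<in> {0..1}" "\<bar>x k m 1 - t\<bar> = h"
  proof (cases "x k m 1 \<le> 1 / 2")
    case True
    then show ?thesis using that[of "x k m 1 + h"] x1 h by auto
  next
    case False
    then show ?thesis using that[of "x k m 1 - h"] x1 h by auto
  qed
  have "h \<le> \<bar>x k m l - t\<bar>" if l: "l \<in> {1..m}" for l
  proof (cases "l = 1")
    case False
    then have "1 \<le> \<bar>real l - real 1\<bar>" using l by auto
    also have "\<dots> \<le> F * real m * \<bar>x k m l - x k m 1\<bar>" using l assms by (intro separation) auto
    finally have "F * real m * (2 * h) \<le> F * real m * \<bar>x k m l - x k m 1\<bar>" using h_eq by simp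
    then have "2 * h \<le> \<bar>x k m l - x k m 1\<bar>" using Fm by (simp add: mult_le_cancel_left_pos)
    then show ?thesis using t by linarith
  qed (use t in simp)
  then show ?thesis unfolding h_def[symmetric] using t by blast
qed

text \<open>Only indices in a product of windows of radius h contribute, and
  \<open>card_design_interval\<close> bounds each factor of their number.\<close>

lemma sum_squares_bump_le:
  fixes g :: "real ^ 'd \<Rightarrow> real"
  assumes "h > 0" and "h * real (p_min p) \<ge> 1"
    and g: "\<And>z. \<bar>g z\<bar> \<le> S" and supp: "\<And>z i. h \<le> \<bar>z $ i - t\<bar> \<Longrightarrow> g z = 0"
  shows "(\<Sum>(i, j)\<in>obs_index n p. (g (design_point x p j))\<^sup>2)
    \<le> real n * real (p_prod p) * ((2 * F + 1) * h) ^ CARD('d) * S\<^sup>2"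
proof -
  define J where "J = {j. \<forall>k. 1 \<le> j k \<and> j k \<le> p k}"
  define J' where "J' = (\<Pi>\<^sub>E k\<in>UNIV. {l\<in>{1..p k}. \<bar>x k (p k) l - t\<bar> < h})"
  have J: "J = (\<Pi>\<^sub>E k\<in>UNIV. {1..p k})" by (auto simp: J_def PiE_iff)
  have fin: "finite J" "finite J'" by (auto simp: J J'_def intro!: finite_PiE)
  have "(\<Sum>j\<in>J. (g (design_point x p j))\<^sup>2) = (\<Sum>j\<in>J'. (g (design_point x p j))\<^sup>2)"
  proof (rule sum.mono_neutral_right)
    show "J' \<subseteq> J" by (auto simp: J J'_def PiE_iff)
    show "\<forall>j\<in>J - J'. (g (design_point x p j))\<^sup>2 = 0"
    proof
      fix j assume "j \<in> J - J'"
      then obtain k where "h \<le> \<bar>x k (p k) (j k) - t\<bar>" by (auto simp: J J'_def PiE_iff not_less)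
      then show "(g (design_point x p j))\<^sup>2 = 0" by (simp add: supp[of _ k] design_point_def)
    qed
  qed (fact fin)
  also have "\<dots> \<le> (\<Sum>j\<in>J'. S\<^sup>2)" using g by (intro sum_mono) (metis abs_le_square_iff abs_ge_self order_trans)
  also have "\<dots> = real (card J') * S\<^sup>2" by simp
  also have "real (card J') \<le> real (p_prod p) * ((2 * F + 1) * h) ^ CARD('d)"
  proof -
    have "real (card J') = (\<Prod>k\<in>UNIV. real (card {l\<in>{1..p k}. \<bar>x k (p k) l - t\<bar> < h}))"
      by (simp add: J'_def card_PiE)
    also have "\<dots> \<le> (\<Prod>k\<in>UNIV. real (p k) * ((2 * F + 1) * h))"
    proof (intro prod_mono conjI)
      fix k
      have "p_min p \<le> p k" by (simp add: p_min_def)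
      then have "h * real (p_min p) \<le> h * real (p k)" using assms(1) by (intro mult_left_mono) auto
      \<comment> \<open>This absorbs the additive 1 of the window count into the factor 2 F +
        1.\<close>
      with assms(2) have "1 \<le> h * real (p k)" by linarith
      then show "real (card {l\<in>{1..p k}. \<bar>x k (p k) l - t\<bar> < h}) \<le> real (p k) * ((2 * F + 1) * h)"
        using card_design_interval[OF assms(1), where m = "p k" and k = k and t = t] by (simp add: algebra_simps)
    qed simp
    finally show ?thesis by (simp add: p_prod_def prod.distrib)
  qed
  finally have "(\<Sum>j\<in>J. (g (design_point x p j))\<^sup>2)
      \<le> real (p_prod p) * ((2 * F + 1) * h) ^ CARD('d) * S\<^sup>2"
    by (simp add: mult_right_mono)
  then have "real n * (\<Sum>j\<in>J. (g (design_point x p j))\<^sup>2)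
      \<le> real n * (real (p_prod p) * ((2 * F + 1) * h) ^ CARD('d) * S\<^sup>2)"
    by (intro mult_left_mono) auto
  moreover have "(\<Sum>(i, j)\<in>obs_index n p. (g (design_point x p j))\<^sup>2)
      = real n * (\<Sum>j\<in>J. (g (design_point x p j))\<^sup>2)"
    unfolding obs_index_def J_def[symmetric] by (simp flip: sum.cartesian_product)
  ultimately show ?thesis by (simp add: mult_ac)
qed

end

lemma ex_bounded_design:
  assumes "\<And>k. design_density (f k)" and "generated_design f x"
  shows "\<exists>F. bounded_design f x F"
proof -
  have "\<exists>F. \<forall>t\<in>{0..1}. 0 \<le> f k t \<and> f k t \<le> F" for k
    using assms(1)[of k] unfolding design_density_def by (meson less_imp_le order_trans)
  then obtain F where F: "\<And>k t. t \<in> {0..1} \<Longrightarrow> 0 \<le> f k t \<and> f k t \<le> F k" by metis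
  have "F k \<le> 1 + (\<Sum>k\<in>UNIV. \<bar>F k\<bar>)" for k
    using member_le_sum[of k UNIV "\<lambda>k. \<bar>F k\<bar>"] by simp
  then have "0 \<le> f k t \<and> f k t \<le> 1 + (\<Sum>k\<in>UNIV. \<bar>F k\<bar>)" if "t \<in> {0..1}" for k t
    using F[OF that, of k] by (meson order_trans)
  moreover have "1 \<le> 1 + (\<Sum>k\<in>UNIV. \<bar>F k\<bar>)" by (simp add: sum_nonneg)
  \<comment> \<open>The sum makes the bound uniform in k, and the added 1 secures F >= 1.\<close>
  ultimately have "bounded_design f x (1 + (\<Sum>k\<in>UNIV. \<bar>F k\<bar>))"
    unfolding bounded_design_def using assms(2) by blast
  then show ?thesis by blast
qed


section \<open>Laws of the observations\<close>

lemma distr_pair_snd: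
  assumes "prob_space M" and "prob_space N"
  shows "distr (M \<Otimes>\<^sub>M N) N snd = N"
proof -
  interpret M: prob_space M by fact
  interpret N: prob_space N by fact
  show ?thesis
  proof (intro measure_eqI)
    fix A assume A: "A \<in> sets (distr (M \<Otimes>\<^sub>M N) N snd)"
    then have "emeasure (distr (M \<Otimes>\<^sub>M N) N snd) A = emeasure (M \<Otimes>\<^sub>M N) (space M \<times> A)"
      using sets.sets_into_space[of A N]
      by (auto simp: emeasure_distr space_pair_measure intro!: arg_cong[where f="emeasure (M \<Otimes>\<^sub>M N)"])
    also have "\<dots> = emeasure N A"
      using A by (simp add: N.emeasure_pair_measure_Times M.emeasure_space_1)
    finally show "emeasure (distr (M \<Otimes>\<^sub>M N) N snd) A = emeasure N A" .
  qed simp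
qed

lemma distr_gauss_plus: "distr (gauss 0 \<sigma>) borel ((+) a) = gauss a \<sigma>"
proof -
  have "gauss a \<sigma> = density (distr lborel borel ((+) a)) (\<lambda>t. ennreal (normal_density a \<sigma> t))"
    by (simp add: lborel_distr_plus)
  also have "\<dots> = distr (density lborel (\<lambda>t. ennreal (normal_density a \<sigma> (a + t)))) borel ((+) a)"
    by (rule density_distr) measurable
  also have "(\<lambda>t. ennreal (normal_density a \<sigma> (a + t))) = (\<lambda>t. ennreal (normal_density 0 \<sigma> t))"
    by (simp add: normal_density_def)
  finally show ?thesis by (rule sym)
qed

text \<open>A shift of the noise becomes a change of measure on one common base. The outer identity
  map replaces the sigma-algebra by that of the observation space and gives the form
  \<open>distr (density B \<dots>) N G\<close> used by the risk bound.\<close>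

lemma distr_PiM_gauss_plus:
  assumes "finite I" and "\<sigma> > 0"
  shows "distr (PiM I (\<lambda>_. gauss 0 \<sigma>)) (PiM I (\<lambda>_. borel)) (\<lambda>y. \<lambda>i\<in>I. a i + y i)
    = distr (density (PiM I (\<lambda>_. gauss 0 \<sigma>)) (\<lambda>y. ennreal (gauss_likelihood \<sigma> I a y)))
        (PiM I (\<lambda>_. borel)) (\<lambda>y. y)"
proof -
  have "distr (PiM I (\<lambda>_. gauss 0 \<sigma>)) (PiM I (\<lambda>_. borel)) (\<lambda>y. \<lambda>i\<in>I. a i + y i)
      = PiM I (\<lambda>i. distr (gauss 0 \<sigma>) borel ((+) (a i)))"
    using assms by (intro distr_PiM_componentwise prob_space_normal_density) auto
  also have "\<dots> = density (PiM I (\<lambda>_. gauss 0 \<sigma>)) (\<lambda>y. ennreal (gauss_likelihood \<sigma> I a y))"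
    unfolding distr_gauss_plus by (rule PiM_gauss_eq_density) fact+
  also have "\<dots> = distr \<dots> (PiM I (\<lambda>_. borel)) (\<lambda>y. y)"
    by (rule distr_id2[symmetric]) (simp, intro sets_PiM_cong, auto)
  finally show ?thesis .
qed

lemma obs_law_zero_field:
  assumes "prob_space \<Omega>" and "\<sigma> > 0"
  shows "obs_law x \<sigma> n p \<mu> \<Omega> (\<lambda>_ _. 0)
    = distr (density (PiM (obs_index n p) (\<lambda>_. gauss 0 \<sigma>))
          (\<lambda>y. ennreal (gauss_likelihood \<sigma> (obs_index n p) (\<lambda>(i, j). \<mu> (design_point x p j)) y)))
        (obs_space n p) (\<lambda>y. y)"
proof -
  let ?I = "obs_index n p" and ?E = "PiM (obs_index n p) (\<lambda>_. gauss 0 \<sigma>)" and ?P = "PiM {1..n} (\<lambda>_. \<Omega>)"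
  let ?a = "\<lambda>(i::nat, j). \<mu> (design_point x p j)"
  have E: "sets ?E = sets (obs_space n p)" by (intro sets_PiM_cong) auto
  have "(\<lambda>y. \<lambda>q\<in>?I. ?a q + y q) \<in> measurable (obs_space n p) (obs_space n p)"
    by (intro measurable_restrict borel_measurable_add measurable_const measurable_component_singleton) auto
  then have shift: "(\<lambda>y. \<lambda>q\<in>?I. ?a q + y q) \<in> measurable ?E (obs_space n p)"
    by (subst measurable_cong_sets[OF E refl])
  \<comment> \<open>With the zero field the observations are a function of the errors alone, so the
    law reduces to the second marginal.\<close>
  have fn: "(\<lambda>(\<omega>, \<epsilon>). \<lambda>(i, j)\<in>?I. \<mu> (design_point x p j) + 0 + \<epsilon> (i, j))
      = (\<lambda>y. \<lambda>q\<in>?I. ?a q + y q) \<circ> snd"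
    by (rule ext) (simp add: split_beta' del: restrict_apply)
  have snd: "distr (?P \<Otimes>\<^sub>M ?E) ?E snd = ?E"
    using assms by (intro distr_pair_snd prob_space_PiM prob_space_normal_density)
  have dd: "distr (?P \<Otimes>\<^sub>M ?E) (obs_space n p) ((\<lambda>y. \<lambda>q\<in>?I. ?a q + y q) \<circ> snd)
      = distr (distr (?P \<Otimes>\<^sub>M ?E) ?E snd) (obs_space n p) (\<lambda>y. \<lambda>q\<in>?I. ?a q + y q)"
    by (rule distr_distr[symmetric, OF shift measurable_snd])
  show ?thesis
    unfolding obs_law_def fn dd snd
    by (rule distr_PiM_gauss_plus[OF finite_obs_index \<open>\<sigma> > 0\<close>])
qed

lemma zero_field_in_process_class:
  assumes "prob_space \<Omega>" and "C > 0" and "\<beta>\<^sub>0 \<le> 1"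
  shows "(\<Omega>, \<lambda>_ _. 0) \<in> (process_class \<beta>\<^sub>0 C :: 'd::finite field set)"
proof -
  interpret prob_space \<Omega> by fact
  show ?thesis
    unfolding process_class_def centered_field_def using assms
    \<comment> \<open>The Hoelder constant M has to be strictly positive even for the zero field;
      the constant sqrt C uses exactly the budget C.\<close>
    by (auto intro!: bexI[of _ 1] bexI[of _ "\<lambda>_. sqrt C"] simp: prob_space)
qed

section \<open>A random level as process\<close>

text \<open>A normal random level carried by the second component of the sample type.\<close>

definition gauss_sample :: "real \<Rightarrow> ('d::finite) sample measure" where
  "gauss_sample s = distr (gauss 0 s) (count_space UNIV \<Otimes>\<^sub>M borel) (Pair (\<lambda>_. 0))"

lemma Pair_gauss_measurable [measurable]:
  "Pair (\<lambda>_. 0) \<in> measurable (gauss 0 s) (count_space UNIV \<Otimes>\<^sub>M borel)"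
  by measurable

lemma sets_gauss_sample [measurable_cong, simp]:
  "sets (gauss_sample s) = sets (count_space UNIV \<Otimes>\<^sub>M borel)"
  by (simp add: gauss_sample_def)

lemma prob_space_gauss_sample: "s > 0 \<Longrightarrow> prob_space (gauss_sample s)"
  unfolding gauss_sample_def
  by (intro prob_space.prob_space_distr prob_space_normal_density Pair_gauss_measurable)

lemma distr_gauss_sample_snd:
  "distr (gauss_sample s :: 'd::finite sample measure) borel (\<lambda>\<omega>. c + snd \<omega>) = gauss c s"
proof -
  have "distr (gauss_sample s :: 'd sample measure) borel (\<lambda>\<omega>. c + snd \<omega>)
      = distr (gauss 0 s) borel ((\<lambda>\<omega> :: 'd sample. c + snd \<omega>) \<circ> Pair (\<lambda>_. 0))"
    unfolding gauss_sample_def by (rule distr_distr) measurable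
  also have "(\<lambda>\<omega> :: 'd sample. c + snd \<omega>) \<circ> Pair (\<lambda>_. 0) = (+) c" by auto
  finally show ?thesis by (simp add: distr_gauss_plus)
qed

text \<open>The budget is split evenly: the level has variance C/2, and M is the constant sqrt
  (C/2). The paths are constant, so any positive M bounds their increments.\<close>

lemma gauss_level_in_process_class:
  assumes "C > 0" and "\<beta>\<^sub>0 \<le> 1"
  shows "(gauss_sample (sqrt (C / 2)), \<lambda>\<omega> _. snd \<omega>) \<in> (process_class \<beta>\<^sub>0 C :: 'd::finite field set)"
proof -
  define s where "s = sqrt (C / 2)"
  have s: "s > 0" "s\<^sup>2 = C / 2" using assms by (auto simp: s_def)
  let ?\<Omega> = "gauss_sample s :: 'd sample measure"
  interpret prob_space ?\<Omega> by (rule prob_space_gauss_sample) fact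
  have m1: "has_bochner_integral (gauss 0 s) (\<lambda>t. t) 0"
    using normal_moment_odd[OF s(1), of 0 0] by (intro has_bochner_integral_density) simp_all
  have m2: "has_bochner_integral (gauss 0 s) (\<lambda>t. t\<^sup>2) (s\<^sup>2)"
    using normal_moment_even[OF s(1), of 0 1] by (intro has_bochner_integral_density) simp_all
  have sm [measurable]: "snd \<in> borel_measurable (count_space (UNIV :: (real ^ 'd \<Rightarrow> real) set) \<Otimes>\<^sub>M (borel :: real measure))"
    by measurable
  have "has_bochner_integral ?\<Omega> snd 0"
    unfolding gauss_sample_def using m1
    by (intro has_bochner_integral_distr[OF sm Pair_gauss_measurable]) (simp only: snd_conv)
  note int1 = has_bochner_integral_integral_eq[OF this]
  have "has_bochner_integral ?\<Omega> (\<lambda>\<omega>. (snd \<omega>)\<^sup>2) (s\<^sup>2)"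
    unfolding gauss_sample_def using m2
    by (intro has_bochner_integral_distr[OF borel_measurable_power[OF sm] Pair_gauss_measurable])
       (simp only: snd_conv)
  note int2 = has_bochner_integral_integral_eq[OF this] integrable.intros[OF this]
  note int = int1 int2
  have "snd \<in> borel_measurable ?\<Omega>" by measurable
  then have "centered_field ?\<Omega> (\<lambda>\<omega> _ :: real ^ 'd. snd \<omega>)"
    unfolding centered_field_def using int prob_space_axioms by blast
  moreover have "(\<integral>\<omega>. s\<^sup>2 \<partial>?\<Omega>) + (\<integral>\<omega>. (snd \<omega>)\<^sup>2 \<partial>?\<Omega>) \<le> C"
    by (simp add: prob_space int s(2))
  moreover have "AE \<omega> in ?\<Omega>. \<forall>x\<in>cube. \<forall>y\<in>cube.
      \<bar>snd \<omega> - snd \<omega>\<bar> \<le> s * infnorm (x - y :: real ^ 'd) powr 1"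
    using s by (simp add: infnorm_pos_le)
  moreover have "(\<lambda>_. s) \<in> borel_measurable ?\<Omega>" "integrable ?\<Omega> (\<lambda>_. s\<^sup>2)" by simp_all
  moreover have "\<forall>\<omega>\<in>space ?\<Omega>. s > 0" "1 \<in> {\<beta>\<^sub>0..1}" using s assms by simp_all
  ultimately have "(?\<Omega>, \<lambda>\<omega> _. snd \<omega>) \<in> (process_class \<beta>\<^sub>0 C :: 'd field set)"
    unfolding process_class_def mem_Collect_eq prod.case by (intro conjI bexI[of _ 1] bexI[of _ "\<lambda>_. s"])
  then show ?thesis by (simp add: s_def)
qed

text \<open>A constant mean c plus N(0, s^2) levels is the same as N(c, s^2) levels. Hence c enters
  only through the n latent levels, and changing c is a change of measure on them, made before
  \<open>G\<close> produces the observations.\<close>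

lemma obs_law_gauss_level:
  fixes x :: "'d::finite \<Rightarrow> nat \<Rightarrow> nat \<Rightarrow> real" and p :: "'d \<Rightarrow> nat" and n :: nat
  assumes "s > 0" and "\<sigma> > 0"
  defines "B \<equiv> PiM {1..n} (\<lambda>_. gauss 0 s) \<Otimes>\<^sub>M PiM (obs_index n p) (\<lambda>_. gauss 0 \<sigma>)"
    and "G \<equiv> \<lambda>(z, \<epsilon>). \<lambda>(i, j)\<in>obs_index n p. z i + \<epsilon> (i, j)"
  shows "obs_law x \<sigma> n p (\<lambda>_. c) (gauss_sample s :: 'd sample measure) (\<lambda>\<omega> _. snd \<omega>)
    = distr (density B (\<lambda>w. ennreal (gauss_likelihood s {1..n} (\<lambda>_. c) (fst w)))) (obs_space n p) G"
    and "G \<in> measurable B (obs_space n p)"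
proof -
  let ?\<Omega> = "gauss_sample s :: 'd sample measure"
  let ?P = "PiM {1..n} (\<lambda>_. ?\<Omega>)" and ?Q = "PiM {1..n} (\<lambda>_. gauss 0 s)" and ?R = "PiM {1..n} (\<lambda>_. borel :: real measure)"
    and ?E = "PiM (obs_index n p) (\<lambda>_. gauss 0 \<sigma>)"
  have sE [measurable_cong]: "sets ?E = sets (obs_space n p)" by (intro sets_PiM_cong) auto
  have sQ [measurable_cong]: "sets ?Q = sets ?R" by (intro sets_PiM_cong) auto
  have Gm: "G \<in> measurable (?R \<Otimes>\<^sub>M obs_space n p) (obs_space n p)"
    unfolding G_def split_beta'
  proof (rule measurable_restrict)
    fix q assume "q \<in> obs_index n p"
    then have q: "fst q \<in> {1..n}" "(fst q, snd q) \<in> obs_index n p" by (auto simp: obs_index_def)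
    show "(\<lambda>w. fst w (fst q) + snd w (fst q, snd q)) \<in> borel_measurable (?R \<Otimes>\<^sub>M obs_space n p)"
      by (intro borel_measurable_add
          measurable_compose[OF measurable_fst measurable_component_singleton[OF q(1)]]
          measurable_compose[OF measurable_snd measurable_component_singleton[OF q(2)]])
  qed
  then show "G \<in> measurable B (obs_space n p)"
    unfolding B_def by (subst measurable_cong_sets[OF sets_pair_measure_cong[OF sQ sE] refl])
  \<comment> \<open>\<open>T\<close> replaces the sample points by the shifted levels; the
    observation map factors through it.\<close>
  define T where "T = (\<lambda>\<omega>. \<lambda>i\<in>{1..n}. c + snd (\<omega> i :: 'd sample))"
  have T [measurable]: "T \<in> measurable ?P ?R"
    unfolding T_def
  proof (rule measurable_restrict)
    fix i assume [measurable]: "i \<in> {1..n}"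
    show "(\<lambda>\<omega>. c + snd (\<omega> i :: 'd sample)) \<in> borel_measurable ?P" by measurable
  qed
  have prE: "prob_space ?E" using assms by (intro prob_space_PiM prob_space_normal_density)
  interpret E: prob_space ?E by (rule prE)
  have fn: "(\<lambda>(\<omega>, \<epsilon>). \<lambda>(i, j)\<in>obs_index n p. c + snd (\<omega> i) + \<epsilon> (i, j))
      = G \<circ> (\<lambda>(\<omega>, \<epsilon>). (T \<omega>, \<epsilon>))"
  proof
    fix w :: "(nat \<Rightarrow> 'd sample) \<times> (nat \<times> ('d \<Rightarrow> nat) \<Rightarrow> real)"
    obtain \<omega> \<epsilon> where w: "w = (\<omega>, \<epsilon>)" by fastforce
    show "(\<lambda>(\<omega>, \<epsilon>). \<lambda>(i, j)\<in>obs_index n p. c + snd (\<omega> i) + \<epsilon> (i, j)) w = (G \<circ> (\<lambda>(\<omega>, \<epsilon>). (T \<omega>, \<epsilon>))) w"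
      unfolding w o_apply prod.case G_def
      by (rule restrict_ext) (auto simp: T_def obs_index_def)
  qed
  have dd: "distr (?P \<Otimes>\<^sub>M ?E) (obs_space n p) (G \<circ> (\<lambda>(\<omega>, \<epsilon>). (T \<omega>, \<epsilon>)))
      = distr (distr (?P \<Otimes>\<^sub>M ?E) (?R \<Otimes>\<^sub>M obs_space n p) (\<lambda>(\<omega>, \<epsilon>). (T \<omega>, \<epsilon>))) (obs_space n p) G"
    by (rule distr_distr[symmetric, OF Gm]) measurable
  have E_eq: "distr ?E (obs_space n p) (\<lambda>y. y) = ?E"
    using sE by (intro distr_id2) (rule sym)
  have T_law: "distr ?P ?R T = density ?Q (\<lambda>z. ennreal (gauss_likelihood s {1..n} (\<lambda>_. c) z))"
  proof -
    have "distr ?P ?R T = PiM {1..n} (\<lambda>i. distr ?\<Omega> borel (\<lambda>\<omega>. c + snd \<omega>))"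
      unfolding T_def by (intro distr_PiM_componentwise prob_space_gauss_sample assms) auto
    then show ?thesis
      unfolding distr_gauss_sample_snd using PiM_gauss_eq_density[OF _ assms(1), of "{1..n}" "\<lambda>_. c"] by simp
  qed
  have "distr (?P \<Otimes>\<^sub>M ?E) (?R \<Otimes>\<^sub>M obs_space n p) (\<lambda>(\<omega>, \<epsilon>). (T \<omega>, \<epsilon>))
      = distr ?P ?R T \<Otimes>\<^sub>M distr ?E (obs_space n p) (\<lambda>y. y)"
  proof (rule pair_measure_distr[symmetric, OF T])
    show "(\<lambda>y. y) \<in> measurable ?E (obs_space n p)" by measurable
    show "sigma_finite_measure (distr ?E (obs_space n p) (\<lambda>y. y))"
      unfolding E_eq by (rule E.sigma_finite_measure_axioms)
  qed
  \<comment> \<open>The errors receive the trivial density 1 so that the rule for products of two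
    densities applies.\<close>
  then have pair: "distr (?P \<Otimes>\<^sub>M ?E) (?R \<Otimes>\<^sub>M obs_space n p) (\<lambda>(\<omega>, \<epsilon>). (T \<omega>, \<epsilon>))
      = density ?Q (\<lambda>z. ennreal (gauss_likelihood s {1..n} (\<lambda>_. c) z)) \<Otimes>\<^sub>M density ?E (\<lambda>_. 1)"
    unfolding T_law E_eq density_1 .
  have dens: "density ?Q (\<lambda>z. ennreal (gauss_likelihood s {1..n} (\<lambda>_. c) z)) \<Otimes>\<^sub>M density ?E (\<lambda>_. 1)
      = density B (\<lambda>w. ennreal (gauss_likelihood s {1..n} (\<lambda>_. c) (fst w)))"
  proof (rule trans[OF pair_measure_density])
    show "sigma_finite_measure ?E" "sigma_finite_measure (density ?E (\<lambda>_. 1))"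
      unfolding density_1 by (rule E.sigma_finite_measure_axioms)+
    show "(\<lambda>z. ennreal (gauss_likelihood s {1..n} (\<lambda>_. c) z)) \<in> borel_measurable ?Q"
      by (rule measurable_compose[OF gauss_likelihood_measurable measurable_ennreal])
    show "density (?Q \<Otimes>\<^sub>M ?E) (\<lambda>(z, \<epsilon>). ennreal (gauss_likelihood s {1..n} (\<lambda>_. c) z) * 1)
        = density B (\<lambda>w. ennreal (gauss_likelihood s {1..n} (\<lambda>_. c) (fst w)))"
      unfolding B_def by (simp only: mult_1_right split_beta')
  qed simp
  show "obs_law x \<sigma> n p (\<lambda>_. c) ?\<Omega> (\<lambda>\<omega> _. snd \<omega>)
    = distr (density B (\<lambda>w. ennreal (gauss_likelihood s {1..n} (\<lambda>_. c) (fst w)))) (obs_space n p) G"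
    unfolding obs_law_def fn dd pair dens by (rule refl)
qed


section \<open>Lower bounds on the worst-case risk\<close>

text \<open>The inner supremum of the theorem, bounded below separately for each term of the
  rate.\<close>

definition worst_risk ::
  "('d::finite \<Rightarrow> nat \<Rightarrow> nat \<Rightarrow> real) \<Rightarrow> real \<Rightarrow> real \<Rightarrow> real \<Rightarrow> real \<Rightarrow> real \<Rightarrow> nat \<Rightarrow> ('d \<Rightarrow> nat) \<Rightarrow>
   ((nat \<times> ('d \<Rightarrow> nat) \<Rightarrow> real) \<Rightarrow> real ^ 'd \<Rightarrow> real) \<Rightarrow> ennreal" where
  "worst_risk x \<sigma> \<alpha> L \<beta>\<^sub>0 C n p h =
     (SUP (\<mu>, \<Omega>, Z)\<in>hoelder_class \<alpha> L \<times> (process_class \<beta>\<^sub>0 C :: 'd field set). scaled_risk x \<sigma> \<alpha> n p h \<mu> \<Omega> Z)"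

lemma scaled_risk_le_worst_risk:
  fixes x :: "'d::finite \<Rightarrow> nat \<Rightarrow> nat \<Rightarrow> real"
  assumes "\<mu> \<in> hoelder_class \<alpha> L" and "(\<Omega>, Z) \<in> (process_class \<beta>\<^sub>0 C :: 'd field set)"
  shows "scaled_risk x \<sigma> \<alpha> n p h \<mu> \<Omega> Z \<le> worst_risk x \<sigma> \<alpha> L \<beta>\<^sub>0 C n p h"
  unfolding worst_risk_def by (rule SUP_upper2[of "(\<mu>, \<Omega>, Z)"]) (use assms in auto)

lemma rate_nonneg: "0 \<le> rate \<alpha> n p"
  unfolding rate_def by (rule order_trans[of _ "real n powr (- 1 / 2)"]) (auto intro!: Max_ge)

text \<open>For a zero process the sum in \<open>gram\<close> is the second moment of the summed
  likelihood ratios, by \<open>nn_integral_gauss_likelihood_mult\<close>. The hypothesis thus says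
  that their average has second moment at most 2.\<close>

lemma worst_risk_ge_bumps:
  fixes x :: "'d::finite \<Rightarrow> nat \<Rightarrow> nat \<Rightarrow> real" and \<mu> :: "'k \<Rightarrow> real ^ 'd \<Rightarrow> real"
  assumes "L \<ge> 0" and "C > 0" and "\<beta>\<^sub>0 \<le> 1" and "\<sigma> > 0" and "h \<in> estimators n p"
    and K: "finite K" "K \<noteq> {}" and "b \<ge> 0"
    and \<mu>: "\<And>m. m \<in> K \<Longrightarrow> \<mu> m \<in> hoelder_class \<alpha> L" "\<And>m. m \<in> K \<Longrightarrow> \<mu> m (t m) = b"
    and t: "\<And>m. m \<in> K \<Longrightarrow> t m \<in> cube"
    and gram: "(\<Sum>m\<in>K. \<Sum>m'\<in>K. exp (\<Sum>(i, j)\<in>obs_index n p.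
        \<mu> m (design_point x p j) * \<mu> m' (design_point x p j) / \<sigma>\<^sup>2)) \<le> 2 * (real (card K))\<^sup>2"
  shows "ennreal (inverse (rate \<alpha> n p) * b / 4) \<le> worst_risk x \<sigma> \<alpha> L \<beta>\<^sub>0 C n p h"
proof -
  \<comment> \<open>Merely a probability space of the required sample type to carry the zero
    field.\<close>
  let ?\<Omega> = "gauss_sample 1 :: 'd sample measure"
  have \<Omega>: "prob_space ?\<Omega>" by (rule prob_space_gauss_sample) simp
  note zero = zero_field_in_process_class[OF \<Omega> \<open>C > 0\<close> \<open>\<beta>\<^sub>0 \<le> 1\<close>]
  have null: "(\<lambda>_. 0) \<in> (hoelder_class \<alpha> L :: (real ^ 'd \<Rightarrow> real) set)"
    using \<open>L \<ge> 0\<close> by (intro const_in_hoelder_class) simp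
  let ?I = "obs_index n p"
  let ?B = "PiM ?I (\<lambda>_. gauss 0 \<sigma>)"
  define a where "a m = (\<lambda>(i::nat, j). \<mu> m (design_point x p j))" for m
  have sets_B: "sets ?B = sets (obs_space n p)" by (intro sets_PiM_cong) auto
  have null_law: "distr ?B (obs_space n p) (\<lambda>y. y) = obs_law x \<sigma> n p (\<lambda>_. 0) ?\<Omega> (\<lambda>_ _. 0)"
  proof -
    have "gauss_likelihood \<sigma> ?I (\<lambda>(i, j). 0) = (\<lambda>_. 1)"
      by (simp add: gauss_likelihood_def fun_eq_iff split_beta')
    then show ?thesis
      unfolding obs_law_zero_field[OF \<Omega> \<open>\<sigma> > 0\<close>] by (simp add: density_1)
  qed
  have alt_law: "distr (density ?B (\<lambda>y. ennreal (gauss_likelihood \<sigma> ?I (a m) y))) (obs_space n p) (\<lambda>y. y)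
      = obs_law x \<sigma> n p (\<mu> m) ?\<Omega> (\<lambda>_ _. 0)" for m
    unfolding obs_law_zero_field[OF \<Omega> \<open>\<sigma> > 0\<close>] a_def ..
  show ?thesis
  proof (rule sup_norm_risk_lower_bound[where B = ?B and N = "obs_space n p" and G = "\<lambda>y. y" and K = K
        and \<rho> = "\<lambda>m. gauss_likelihood \<sigma> ?I (a m)" and h = h and t = t and \<mu> = \<mu>])
    show "prob_space ?B" using \<open>\<sigma> > 0\<close> by (intro prob_space_PiM prob_space_normal_density)
    show "0 \<le> inverse (rate \<alpha> n p)" by (simp add: rate_nonneg)
    show "gauss_likelihood \<sigma> ?I (a m) \<in> borel_measurable ?B" for m
      by (rule gauss_likelihood_measurable)
    show "(\<integral>\<^sup>+y. ennreal (gauss_likelihood \<sigma> ?I (a m) y) \<partial>?B) = 1" for m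
      by (rule nn_integral_gauss_likelihood[OF finite_obs_index \<open>\<sigma> > 0\<close>])
    show "(\<Sum>m\<in>K. \<Sum>m'\<in>K. \<integral>\<^sup>+y. ennreal (gauss_likelihood \<sigma> ?I (a m) y * gauss_likelihood \<sigma> ?I (a m') y) \<partial>?B)
        \<le> ennreal (2 * (real (card K))\<^sup>2)"
    proof -
      have "(\<Sum>q\<in>?I. a m q * a m' q / \<sigma>\<^sup>2)
          = (\<Sum>(i, j)\<in>?I. \<mu> m (design_point x p j) * \<mu> m' (design_point x p j) / \<sigma>\<^sup>2)" for m m'
        by (simp add: a_def split_beta')
      then show ?thesis
        unfolding nn_integral_gauss_likelihood_mult[OF finite_obs_index \<open>\<sigma> > 0\<close>]
        using ennreal_leI[OF gram] by (simp only: sum_ennreal sum_nonneg exp_ge_zero)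
    qed
    show "(\<lambda>y. y) \<in> measurable ?B (obs_space n p)" using sets_B by (rule measurable_ident_sets)
    show "(\<lambda>y. h y t) \<in> borel_measurable (obs_space n p)" if "t \<in> cube" for t
      using that \<open>h \<in> estimators n p\<close> unfolding estimators_def by blast
    show "(\<integral>\<^sup>+y. ennreal (inverse (rate \<alpha> n p)) * sup_norm (\<lambda>t. h y t - 0) \<partial>distr ?B (obs_space n p) (\<lambda>y. y))
        \<le> worst_risk x \<sigma> \<alpha> L \<beta>\<^sub>0 C n p h"
      using scaled_risk_le_worst_risk[OF null zero, of x \<sigma> n p h] by (simp only: scaled_risk_def null_law)
    show "(\<integral>\<^sup>+y. ennreal (inverse (rate \<alpha> n p)) * sup_norm (\<lambda>t. h y t - \<mu> m t)
          \<partial>distr (density ?B (\<lambda>y. ennreal (gauss_likelihood \<sigma> ?I (a m) y))) (obs_space n p) (\<lambda>y. y))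
        \<le> worst_risk x \<sigma> \<alpha> L \<beta>\<^sub>0 C n p h" if "m \<in> K" for m
      using scaled_risk_le_worst_risk[OF \<mu>(1)[OF that] zero, of x \<sigma> n p h]
      by (simp only: scaled_risk_def alt_law)
    show "0 \<le> gauss_likelihood \<sigma> ?I (a m) y" for m y by (rule gauss_likelihood_nonneg)
  qed (fact K \<mu>(2) t \<open>b \<ge> 0\<close>)+
qed

text \<open>The same random level is used under both hypotheses; the means are 0 and a constant c.
  The ratio has second moment exp (n c^2 / s^2), which stays bounded when c is of order
  n^(-1/2).\<close>

lemma worst_risk_ge_root_n:
  fixes x :: "'d::finite \<Rightarrow> nat \<Rightarrow> nat \<Rightarrow> real"
  assumes "L > 0" and "C > 0" and "\<beta>\<^sub>0 \<le> 1" and "\<sigma> > 0"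
  shows "\<exists>c>0. \<forall>n p h. n \<ge> 1 \<longrightarrow> h \<in> estimators n p \<longrightarrow>
    ennreal (inverse (rate \<alpha> n p) * (c * real n powr (- 1 / 2))) \<le> worst_risk x \<sigma> \<alpha> L \<beta>\<^sub>0 C n p h"
proof -
  define s where "s = sqrt (C / 2)"
  have s: "s > 0" using \<open>C > 0\<close> by (simp add: s_def)
  \<comment> \<open>The bound L keeps the constant in the Hoelder class, and s sqrt (ln 2) makes the
    second moment at most exp (ln 2) = 2.\<close>
  define \<delta> where "\<delta> = min L (s * sqrt (ln 2))"
  have \<delta>: "\<delta> > 0" "\<delta> \<le> L" using s \<open>L > 0\<close> by (auto simp: \<delta>_def)
  have "\<delta>\<^sup>2 \<le> (s * sqrt (ln 2))\<^sup>2" using \<delta> by (intro power_mono) (auto simp: \<delta>_def)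
  then have \<delta>2: "\<delta>\<^sup>2 / s\<^sup>2 \<le> ln 2" using s by (simp add: power_mult_distrib divide_le_eq mult.commute)
  let ?\<Omega> = "gauss_sample s :: 'd sample measure" and ?Z = "\<lambda>\<omega> (_ :: real ^ 'd). snd \<omega> :: real"
  have level: "(?\<Omega>, ?Z) \<in> (process_class \<beta>\<^sub>0 C :: 'd field set)"
    unfolding s_def by (rule gauss_level_in_process_class) fact+
  note const = const_in_hoelder_class[of _ L \<alpha>, where ?'d = 'd]
  show ?thesis
  proof (intro exI[of _ "\<delta> / 4"] conjI allI impI)
    show "\<delta> / 4 > 0" using \<delta> by simp
    fix n and p :: "'d \<Rightarrow> nat" and h assume n: "n \<ge> (1::nat)" and h: "h \<in> estimators n p"
    define c where "c = \<delta> * real n powr (- 1 / 2)"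
    have n_le: "real n powr (- 1 / 2) \<le> 1" using powr_mono[of "- 1 / 2" 0 "real n"] n by simp
    then have c: "0 \<le> c" "c \<le> L" using \<delta> mult_mono[of \<delta> L "real n powr (- 1 / 2)" 1] by (auto simp: c_def)
    have c2: "(\<Sum>i\<in>{1..n}. c * c / s\<^sup>2) \<le> ln 2"
    proof -
      have "c * c = \<delta>\<^sup>2 * (real n powr (- 1 / 2) * real n powr (- 1 / 2))"
        by (simp add: c_def power2_eq_square)
      also have "real n powr (- 1 / 2) * real n powr (- 1 / 2) = 1 / real n"
        unfolding powr_add[symmetric] using n by (simp add: powr_minus inverse_eq_divide)
      finally show ?thesis using n \<delta>2 by simp
    qed
    let ?Q = "PiM {1..n} (\<lambda>_. gauss 0 s)" and ?E = "PiM (obs_index n p) (\<lambda>_. gauss 0 \<sigma>)"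
    let ?B = "?Q \<Otimes>\<^sub>M ?E"
    let ?G = "\<lambda>(z, \<epsilon>). \<lambda>(i, j)\<in>obs_index n p. z i + \<epsilon> (i, j) :: real"
    let ?\<rho> = "gauss_likelihood s {1..n} (\<lambda>_. c)"
    have prQ: "prob_space ?Q" using s by (intro prob_space_PiM prob_space_normal_density)
    have prE: "prob_space ?E" using \<open>\<sigma> > 0\<close> by (intro prob_space_PiM prob_space_normal_density)
    interpret E: prob_space ?E by (rule prE)
    have fst_int: "(\<integral>\<^sup>+w. g (fst w) \<partial>?B) = (\<integral>\<^sup>+z. g z \<partial>?Q)" if "g \<in> borel_measurable ?Q" for g
    proof -
      have "(\<integral>\<^sup>+z. g z \<partial>distr ?B ?Q fst) = (\<integral>\<^sup>+w. g (fst w) \<partial>?B)"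
        by (rule nn_integral_distr[OF measurable_fst]) (simp only: measurable_distr_eq1 that)
      then show ?thesis by (simp only: E.distr_pair_fst)
    qed
    have null_law: "distr ?B (obs_space n p) ?G = obs_law x \<sigma> n p (\<lambda>_. 0) ?\<Omega> ?Z"
      unfolding obs_law_gauss_level(1)[OF s \<open>\<sigma> > 0\<close>] by (simp add: gauss_likelihood_def density_1)
    have "ennreal (inverse (rate \<alpha> n p) * c / 4) \<le> worst_risk x \<sigma> \<alpha> L \<beta>\<^sub>0 C n p h"
    proof (rule sup_norm_risk_lower_bound[where B = ?B and N = "obs_space n p" and G = ?G and K = "{()}"
          and \<rho> = "\<lambda>_ w. ?\<rho> (fst w)" and h = h and t = "\<lambda>_. 0" and \<mu> = "\<lambda>_ _. c"])
      show "prob_space ?B"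
      proof -
        interpret Q: prob_space ?Q by (rule prQ)
        interpret pair_prob_space ?Q ?E ..
        show ?thesis by (rule prob_space_axioms)
      qed
      show "0 \<le> inverse (rate \<alpha> n p)" by (simp add: rate_nonneg)
      show "(\<lambda>w. ?\<rho> (fst w)) \<in> borel_measurable ?B"
        by (rule measurable_compose[OF measurable_fst gauss_likelihood_measurable])
      show "(\<integral>\<^sup>+w. ennreal (?\<rho> (fst w)) \<partial>?B) = 1"
        using fst_int[of "\<lambda>z. ennreal (?\<rho> z)"] nn_integral_gauss_likelihood[of "{1..n}" s "\<lambda>_. c"] s by simp
      show "(\<Sum>m\<in>{()}. \<Sum>m'\<in>{()}. \<integral>\<^sup>+w. ennreal (?\<rho> (fst w) * ?\<rho> (fst w)) \<partial>?B)
          \<le> ennreal (2 * (real (card {()}))\<^sup>2)"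
      proof -
        have "(\<integral>\<^sup>+w. ennreal (?\<rho> (fst w) * ?\<rho> (fst w)) \<partial>?B) = (\<integral>\<^sup>+z. ennreal (?\<rho> z * ?\<rho> z) \<partial>?Q)"
          by (rule fst_int) measurable
        also have "\<dots> = ennreal (exp (\<Sum>i\<in>{1..n}. c * c / s\<^sup>2))"
          using s by (intro nn_integral_gauss_likelihood_mult) auto
        also have "\<dots> \<le> ennreal 2"
        proof (rule ennreal_leI)
          have "exp (\<Sum>i\<in>{1..n}. c * c / s\<^sup>2) \<le> exp (ln 2)" using c2 by (simp only: exp_le_cancel_iff)
          then show "exp (\<Sum>i\<in>{1..n}. c * c / s\<^sup>2) \<le> 2" by simp
        qed
        finally show ?thesis by simp
      qed
      show "?G \<in> measurable ?B (obs_space n p)" by (rule obs_law_gauss_level(2)[OF s \<open>\<sigma> > 0\<close>])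
      show "(\<lambda>y. h y t) \<in> borel_measurable (obs_space n p)" if "t \<in> cube" for t
        using that h unfolding estimators_def by blast
      show "(\<integral>\<^sup>+y. ennreal (inverse (rate \<alpha> n p)) * sup_norm (\<lambda>t. h y t - 0) \<partial>distr ?B (obs_space n p) ?G)
          \<le> worst_risk x \<sigma> \<alpha> L \<beta>\<^sub>0 C n p h"
        using scaled_risk_le_worst_risk[OF const level, of 0 x \<sigma> n p h] \<open>L > 0\<close>
        by (simp only: scaled_risk_def null_law abs_zero less_imp_le simp_thms)
      show "(\<integral>\<^sup>+y. ennreal (inverse (rate \<alpha> n p)) * sup_norm (\<lambda>t. h y t - c)
            \<partial>distr (density ?B (\<lambda>w. ennreal (?\<rho> (fst w)))) (obs_space n p) ?G)
          \<le> worst_risk x \<sigma> \<alpha> L \<beta>\<^sub>0 C n p h"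
        using scaled_risk_le_worst_risk[OF const level, of c x \<sigma> n p h] c
        by (simp only: scaled_risk_def obs_law_gauss_level(1)[OF s \<open>\<sigma> > 0\<close>] abs_of_nonneg)
      show "0 \<le> ?\<rho> (fst w)" for w by (rule gauss_likelihood_nonneg)
      show "(0 :: real ^ 'd) \<in> cube" by (simp add: mem_box_cart)
    qed (use c in simp_all)
    then show "ennreal (inverse (rate \<alpha> n p) * (\<delta> / 4 * real n powr (- 1 / 2))) \<le> worst_risk x \<sigma> \<alpha> L \<beta>\<^sub>0 C n p h"
      by (simp add: c_def)
  qed
qed

section \<open>The two terms obtained from bumps\<close>

lemma vec_in_cube: "t \<in> {0..1} \<Longrightarrow> (vec t :: real ^ 'd) \<in> cube"
  by (simp add: mem_box_cart)

text \<open>A bump that vanishes at every design point leaves the law of the observations unchanged,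
  so its likelihood ratio is identically 1.\<close>

lemma (in bounded_design) worst_risk_ge_discretisation:
  assumes "\<alpha> > 0" and "L > 0" and "C > 0" and "\<beta>\<^sub>0 \<le> 1" and "\<sigma> > 0"
  shows "\<exists>c>0. \<forall>n p h. p_min p \<ge> 1 \<longrightarrow> h \<in> estimators n p \<longrightarrow>
    ennreal (inverse (rate \<alpha> n p) * (c * real (p_min p) powr - \<alpha>)) \<le> worst_risk x \<sigma> \<alpha> L \<beta>\<^sub>0 C n p h"
proof -
  obtain A where "A > 0" and bump: "\<And>t h. 0 < h \<Longrightarrow> h \<le> 1 \<Longrightarrow>
      \<exists>g\<in>(hoelder_class \<alpha> L :: (real ^ 'd \<Rightarrow> real) set). g (vec t) = A * h powr \<alpha> \<and>
      (\<forall>x. \<bar>g x\<bar> \<le> A * h powr \<alpha>) \<and> (\<forall>x i. h \<le> \<bar>x $ i - t\<bar> \<longrightarrow> g x = 0)"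
    using ex_hoelder_bump[OF \<open>\<alpha> > 0\<close> \<open>L > 0\<close>, where ?'d = 'd] by blast
  show ?thesis
  proof (intro exI[of _ "A * (1 / (2 * F)) powr \<alpha> / 4"] conjI allI impI)
    show "A * (1 / (2 * F)) powr \<alpha> / 4 > 0" using \<open>A > 0\<close> F_ge_1 by simp
    fix n and p :: "'d \<Rightarrow> nat" and h assume p: "p_min p \<ge> 1" and h: "h \<in> estimators n p"
    define r where "r = 1 / (2 * F * real (p_min p))"
    \<comment> \<open>The coordinate with the fewest design points has the widest gap guaranteed by
      \<open>ex_design_gap\<close>.\<close>
    have "p_min p \<in> range p" unfolding p_min_def by (rule Min_in) auto
    then obtain k where k: "p k = p_min p" by auto
    have "r > 0" using F_ge_1 p by (simp add: r_def)
    have "r \<le> 1"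
    proof -
      have "1 \<le> 2 * F * real (p_min p)" using mult_mono[of 1 "2 * F" 1 "real (p_min p)"] F_ge_1 p by simp
      then show ?thesis by (simp add: r_def)
    qed
    obtain t where t: "t \<in> {0..1}" and gap: "\<And>l. l \<in> {1..p k} \<Longrightarrow> r \<le> \<bar>x k (p k) l - t\<bar>"
      using ex_design_gap[OF p, of k] unfolding r_def k by blast
    obtain g :: "real ^ 'd \<Rightarrow> real" where g: "g \<in> hoelder_class \<alpha> L" "g (vec t) = A * r powr \<alpha>"
      and supp: "\<And>z i. r \<le> \<bar>z $ i - t\<bar> \<Longrightarrow> g z = 0"
      using bump[OF \<open>r > 0\<close> \<open>r \<le> 1\<close>, of t] by blast
    \<comment> \<open>The k-th coordinate alone already puts each design point outside the support
      of the bump.\<close>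
    have g0: "g (design_point x p j) = 0" if "(i, j) \<in> obs_index n p" for i j
      using that gap[of "j k"] by (intro supp[of _ k]) (simp add: obs_index_def design_point_def)
    have "ennreal (inverse (rate \<alpha> n p) * (A * r powr \<alpha>) / 4) \<le> worst_risk x \<sigma> \<alpha> L \<beta>\<^sub>0 C n p h"
    proof (rule worst_risk_ge_bumps[where K = "{()}" and \<mu> = "\<lambda>_. g" and t = "\<lambda>_. vec t"])
      have "(\<Sum>(i, j)\<in>obs_index n p. g (design_point x p j) * g (design_point x p j) / \<sigma>\<^sup>2) = 0"
        using g0 by (intro sum.neutral) auto
      then show "(\<Sum>m\<in>{()}. \<Sum>m'\<in>{()}. exp (\<Sum>(i, j)\<in>obs_index n p.
          g (design_point x p j) * g (design_point x p j) / \<sigma>\<^sup>2)) \<le> 2 * (real (card {()}))\<^sup>2" by simp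
    qed (use assms h g t \<open>A > 0\<close> vec_in_cube[OF t] in simp_all)
    moreover have "r powr \<alpha> = (1 / (2 * F)) powr \<alpha> * real (p_min p) powr - \<alpha>"
      using F_ge_1 p by (simp add: r_def powr_divide powr_mult powr_minus_divide)
    ultimately show "ennreal (inverse (rate \<alpha> n p) * (A * (1 / (2 * F)) powr \<alpha> / 4 * real (p_min p) powr - \<alpha>))
        \<le> worst_risk x \<sigma> \<alpha> L \<beta>\<^sub>0 C n p h"
      by (simp add: mult_ac)
  qed
qed

text \<open>Here r is the critical bandwidth and e stands for 2\<alpha> + d. The third claim says
  that 1/r is at least N^(1/(2e)): about 1/r bumps have a logarithm comparable to ln N.\<close>

lemma ln_div_powr_bounds:
  fixes N e :: real
  assumes "N \<ge> 2" and "e > 0"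
  defines "r \<equiv> (ln N / N) powr (1 / e)"
  shows "0 < r" and "r powr e = ln N / N" and "ln N / (2 * e) \<le> ln (1 / r)" and "r \<le> 1"
proof -
  have N: "ln N > 0" using assms by simp
  then show "0 < r" using assms by (simp add: r_def)
  show "r powr e = ln N / N" using assms N by (simp add: r_def powr_powr)
  have "(1 + ln N / 4)\<^sup>2 \<le> (exp (ln N / 4))\<^sup>2" using N exp_ge_add_one_self[of "ln N / 4"] by (intro power_mono) auto
  also have "\<dots> = exp (ln N / 2)" by (simp flip: exp_double)
  \<comment> \<open>With y = ln N, expanding (1 - y/4)^2 >= 0 gives y <= (1 + y/4)^2. The outcome is
    ln (ln N) <= ln N / 2.\<close>
  finally have "ln N \<le> exp (ln N / 2)"
    using zero_le_power2[of "1 - ln N / 4"] by (simp add: power2_eq_square algebra_simps)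
  then have "ln (ln N) \<le> ln N / 2" using N by (metis ln_exp ln_le_cancel_iff exp_gt_zero)
  moreover have "ln r = (ln (ln N) - ln N) / e" using N assms by (simp add: r_def ln_powr ln_div)
  moreover have "(ln (ln N) - ln N) / e \<le> - (ln N / 2) / e"
    using \<open>e > 0\<close> \<open>ln (ln N) \<le> ln N / 2\<close> by (intro divide_right_mono) auto
  ultimately have "ln r \<le> - (ln N / 2) / e" by simp
  then have lr: "ln N / (2 * e) \<le> - ln r" by (simp add: mult.commute)
  then show "ln N / (2 * e) \<le> ln (1 / r)" using \<open>0 < r\<close> by (simp add: ln_div)
  have "0 \<le> ln N / (2 * e)" using N \<open>e > 0\<close> by simp
  with lr have "ln r \<le> 0" by linarith
  then show "r \<le> 1" using \<open>0 < r\<close> by simp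
qed

text \<open>The bandwidth is w = \<kappa> r. One bump has exponent at most D w^e N = D \<kappa>^e ln
  N in its second moment, and \<kappa> is small enough for this to stay below ln q, where q is the
  number of bumps.\<close>

lemma (in bounded_design) worst_risk_ge_noise:
  assumes "\<alpha> > 0" and "L > 0" and "C > 0" and "\<beta>\<^sub>0 \<le> 1" and "\<sigma> > 0"
  shows "\<exists>c>0. \<forall>n p h. n \<ge> 2 \<longrightarrow> p_min p \<ge> 1 \<longrightarrow> h \<in> estimators n p \<longrightarrow>
    ennreal (inverse (rate \<alpha> n p) * (c * (ln (real n * real (p_prod p)) / (real n * real (p_prod p)))
        powr (\<alpha> / (2 * \<alpha> + real CARD('d))))) \<le> worst_risk x \<sigma> \<alpha> L \<beta>\<^sub>0 C n p h"
proof -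
  obtain A where "A > 0" and bump: "\<And>t h. 0 < h \<Longrightarrow> h \<le> 1 \<Longrightarrow>
      \<exists>g\<in>(hoelder_class \<alpha> L :: (real ^ 'd \<Rightarrow> real) set). g (vec t) = A * h powr \<alpha> \<and>
      (\<forall>x. \<bar>g x\<bar> \<le> A * h powr \<alpha>) \<and> (\<forall>x i. h \<le> \<bar>x $ i - t\<bar> \<longrightarrow> g x = 0)"
    using ex_hoelder_bump[OF \<open>\<alpha> > 0\<close> \<open>L > 0\<close>, where ?'d = 'd] by blast
  obtain c1 where "c1 > 0" and disc: "\<And>n p h. p_min p \<ge> 1 \<Longrightarrow> h \<in> estimators n p \<Longrightarrow>
      ennreal (inverse (rate \<alpha> n p) * (c1 * real (p_min p) powr - \<alpha>)) \<le> worst_risk x \<sigma> \<alpha> L \<beta>\<^sub>0 C n p h"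
    using worst_risk_ge_discretisation[OF assms] by blast
  define d where "d = CARD('d)"
  define e where "e = 2 * \<alpha> + real d"
  have "e > 0" using \<open>\<alpha> > 0\<close> by (simp add: e_def)
  define D where "D = (2 * F + 1) ^ d * A\<^sup>2 / \<sigma>\<^sup>2"
  have "D > 0" using F_ge_1 \<open>A > 0\<close> \<open>\<sigma> > 0\<close> by (simp add: D_def)
  \<comment> \<open>The second entry gives D \<kappa>^e <= 1/(2e), matching the lower bound on ln
    (1/r). The entry 1/2 gives 2w <= r, so that 1/(2w) is at least 1/r.\<close>
  define \<kappa> where "\<kappa> = min (1 / 2) ((1 / (2 * e * D)) powr (1 / e))"
  have \<kappa>: "\<kappa> > 0" "\<kappa> \<le> 1 / 2" using \<open>D > 0\<close> \<open>e > 0\<close> by (auto simp: \<kappa>_def)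
  have "\<kappa> powr e \<le> ((1 / (2 * e * D)) powr (1 / e)) powr e"
    using \<kappa> \<open>e > 0\<close> by (intro powr_mono2) (auto simp: \<kappa>_def)
  also have "\<dots> = 1 / (2 * e * D)" using \<open>D > 0\<close> \<open>e > 0\<close> by (simp add: powr_powr)
  finally have D\<kappa>: "D * \<kappa> powr e \<le> 1 / (2 * e)" using \<open>D > 0\<close> \<open>e > 0\<close> by (simp add: field_simps)
  \<comment> \<open>The minimum serves both cases below: c1 if w is finer than the design, A/4 if
    bumps are used.\<close>
  define c where "c = min c1 (A / 4) * \<kappa> powr \<alpha>"
  show ?thesis
  proof (intro exI[of _ c] conjI allI impI)
    show "c > 0" using \<open>c1 > 0\<close> \<open>A > 0\<close> \<kappa> by (simp add: c_def)
    fix n and p :: "'d \<Rightarrow> nat" and h assume n: "n \<ge> 2" and p: "p_min p \<ge> 1" and h: "h \<in> estimators n p"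
    define N where "N = real n * real (p_prod p)"
    have "p k \<ge> 1" for k using p Min_le[of "range p" "p k"] by (simp add: p_min_def)
    then have "p_prod p \<ge> 1" unfolding p_prod_def by (intro prod_ge_1) auto
    then have "N \<ge> 2" using n mult_mono[of 2 "real n" 1 "real (p_prod p)"] by (simp add: N_def)
    define r where "r = (ln N / N) powr (1 / e)"
    note r = ln_div_powr_bounds[OF \<open>N \<ge> 2\<close> \<open>e > 0\<close>, folded r_def]
    define w where "w = \<kappa> * r"
    have w: "w > 0" "w \<le> \<kappa>" "2 * w \<le> r" using \<kappa> r mult_left_le[of r \<kappa>] by (auto simp: w_def)
    have target: "(ln N / N) powr (\<alpha> / e) * \<kappa> powr \<alpha> = w powr \<alpha>"
      using \<kappa> r(1) \<open>N \<ge> 2\<close> by (simp add: w_def powr_mult r_def powr_powr)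
    have goal: "ennreal (inverse (rate \<alpha> n p) * (c * (ln N / N) powr (\<alpha> / e))) \<le> worst_risk x \<sigma> \<alpha> L \<beta>\<^sub>0 C n p h"
      if "min c1 (A / 4) * w powr \<alpha> \<le> y" "ennreal (inverse (rate \<alpha> n p) * y) \<le> worst_risk x \<sigma> \<alpha> L \<beta>\<^sub>0 C n p h" for y
    proof -
      have "c * (ln N / N) powr (\<alpha> / e) = min c1 (A / 4) * w powr \<alpha>"
        unfolding target[symmetric] by (simp add: c_def)
      then have "inverse (rate \<alpha> n p) * (c * (ln N / N) powr (\<alpha> / e)) \<le> inverse (rate \<alpha> n p) * y"
        using that(1) rate_nonneg[of \<alpha> n p] by (intro mult_left_mono) auto
      then show ?thesis using that(2) by (metis ennreal_leI order_trans)
    qed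
    have "ennreal (inverse (rate \<alpha> n p) * (c * (ln N / N) powr (\<alpha> / e))) \<le> worst_risk x \<sigma> \<alpha> L \<beta>\<^sub>0 C n p h"
    \<comment> \<open>If w < 1/p_min, the design points in a bump can no longer be counted by
      volume, but then w^\<alpha> <= p_min^(-\<alpha>) and the discretisation bound is already
      strong enough.\<close>
    proof (cases "w * real (p_min p) \<ge> 1")
      case False
      have "w \<le> 1 / real (p_min p)" using False p by (simp add: field_simps)
      then have "w powr \<alpha> \<le> (1 / real (p_min p)) powr \<alpha>" using w \<open>\<alpha> > 0\<close> by (intro powr_mono2) auto
      also have "\<dots> = real (p_min p) powr - \<alpha>" using p by (simp add: powr_divide powr_minus_divide)
      finally have "min c1 (A / 4) * w powr \<alpha> \<le> c1 * real (p_min p) powr - \<alpha>"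
        using \<open>c1 > 0\<close> by (intro mult_mono) auto
      then show ?thesis using disc[OF p h] by (rule goal)
    next
      case True
      \<comment> \<open>Centres 2 w m with m <= 1/(2w) lie in [0,1]. Counting m = 0 as well gives at
        least 1/(2w) of them.\<close>
      define q where "q = Suc (nat \<lfloor>1 / (2 * w)\<rfloor>)"
      have q_ge: "1 / (2 * w) \<le> real q" unfolding q_def using w by linarith
      have centre: "2 * w * real m \<in> {0..1}" if "m < q" for m
      proof -
        have "0 \<le> \<lfloor>1 / (2 * w)\<rfloor>" using w by simp
        then have "int m \<le> \<lfloor>1 / (2 * w)\<rfloor>" using that unfolding q_def by linarith
        then have "real m \<le> 1 / (2 * w)" by (simp only: le_floor_iff of_int_of_nat_eq)
        then have "2 * w * real m \<le> 2 * w * (1 / (2 * w))" using w by (intro mult_left_mono) auto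
        then show ?thesis using w by simp
      qed
      have "w \<le> 1" using w(2) \<kappa>(2) by linarith
      define Q :: "nat \<Rightarrow> (real ^ 'd \<Rightarrow> real) \<Rightarrow> bool" where
        "Q m g \<longleftrightarrow> g \<in> hoelder_class \<alpha> L \<and> g (vec (2 * w * real m)) = A * w powr \<alpha> \<and>
          (\<forall>z. \<bar>g z\<bar> \<le> A * w powr \<alpha>) \<and> (\<forall>z i. w \<le> \<bar>z $ i - 2 * w * real m\<bar> \<longrightarrow> g z = 0)" for m g
      have "\<exists>g. Q m g" for m
        using bump[OF w(1) \<open>w \<le> 1\<close>, of "2 * w * real m"] unfolding Q_def by blast
      from choice[OF allI[OF this]] obtain g where Q: "\<forall>m. Q m (g m)" ..
      have g: "g m \<in> hoelder_class \<alpha> L" "g m (vec (2 * w * real m)) = A * w powr \<alpha>"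
          "\<bar>g m z\<bar> \<le> A * w powr \<alpha>" "w \<le> \<bar>z $ i - 2 * w * real m\<bar> \<Longrightarrow> g m z = 0" for m z i
        using spec[OF Q, of m] unfolding Q_def by blast+
      have disjoint: "g m z * g m' z = 0" if "m \<noteq> m'" for m m' z
      proof (rule ccontr)
        assume ne: "g m z * g m' z \<noteq> 0"
        \<comment> \<open>The centres lie on the diagonal and differ by at least 2w in every
          coordinate, so any coordinate separates the supports.\<close>
        fix i :: 'd
        have "\<bar>z $ i - 2 * w * real m\<bar> < w" "\<bar>z $ i - 2 * w * real m'\<bar> < w"
          using ne g(4)[of z i] by (metis mult_not_zero not_less)+
        then have "\<bar>2 * w * real m - 2 * w * real m'\<bar> < 2 * w" by linarith
        then have "2 * w * \<bar>real m - real m'\<bar> < 2 * w * 1"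
          using w by (simp add: abs_mult flip: right_diff_distrib)
        then have "\<bar>real m - real m'\<bar> < 1" using w by (simp only: mult_less_cancel_left_pos)
        then show False using that by linarith
      qed
      have diag: "exp (\<Sum>(i, j)\<in>obs_index n p. g m (design_point x p j) * g m (design_point x p j) / \<sigma>\<^sup>2) \<le> real q" for m
      proof -
        have "(\<Sum>(i, j)\<in>obs_index n p. g m (design_point x p j) * g m (design_point x p j) / \<sigma>\<^sup>2)
            = (\<Sum>(i, j)\<in>obs_index n p. (g m (design_point x p j))\<^sup>2) / \<sigma>\<^sup>2"
          by (simp add: sum_divide_distrib power2_eq_square split_beta')
        also have "\<dots> \<le> N * ((2 * F + 1) * w) ^ d * (A * w powr \<alpha>)\<^sup>2 / \<sigma>\<^sup>2"
        proof (rule divide_right_mono)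
          show "(\<Sum>(i, j)\<in>obs_index n p. (g m (design_point x p j))\<^sup>2)
              \<le> N * ((2 * F + 1) * w) ^ d * (A * w powr \<alpha>)\<^sup>2"
            unfolding N_def d_def by (rule sum_squares_bump_le[OF w(1) True g(3) g(4)])
        qed simp
        also have "\<dots> = D * (w ^ d * (w powr \<alpha>)\<^sup>2) * N"
          by (simp add: D_def power_mult_distrib)
        \<comment> \<open>The volume w^d and the squared height w^(2\<alpha>) combine to the
          exponent e.\<close>
        also have "w ^ d * (w powr \<alpha>)\<^sup>2 = w powr e"
        proof -
          have "e = \<alpha> + \<alpha> + real d" by (simp add: e_def)
          then show ?thesis by (simp only: powr_add powr_realpow[OF w(1)] power2_eq_square mult_ac)
        qed
        also have "w powr e = \<kappa> powr e * (ln N / N)" using \<kappa> r by (simp add: w_def powr_mult)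
        also have "D * (\<kappa> powr e * (ln N / N)) * N = D * \<kappa> powr e * ln N" using \<open>N \<ge> 2\<close> by simp
        also have "\<dots> \<le> 1 / (2 * e) * ln N" using D\<kappa> \<open>N \<ge> 2\<close> by (intro mult_right_mono) auto
        also have "\<dots> \<le> ln (1 / r)" using r(3) by simp
        also have "\<dots> \<le> ln (1 / (2 * w))" using w r by (intro ln_mono divide_left_mono) auto
        also have "\<dots> \<le> ln (real q)" using q_ge w by (intro ln_mono) auto
        finally have "exp (\<Sum>(i, j)\<in>obs_index n p. g m (design_point x p j) * g m (design_point x p j) / \<sigma>\<^sup>2)
            \<le> exp (ln (real q))" by (simp only: exp_le_cancel_iff)
        then show ?thesis by (simp add: q_def)
      qed
      have "ennreal (inverse (rate \<alpha> n p) * (A * w powr \<alpha>) / 4) \<le> worst_risk x \<sigma> \<alpha> L \<beta>\<^sub>0 C n p h"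
      proof (rule worst_risk_ge_bumps[where K = "{..<q}" and \<mu> = g and t = "\<lambda>m. vec (2 * w * real m)"])
        let ?X = "\<lambda>m m'. exp (\<Sum>(i, j)\<in>obs_index n p. g m (design_point x p j) * g m' (design_point x p j) / \<sigma>\<^sup>2)"
        have "?X m m' \<le> (if m = m' then real q else 0) + 1" for m m'
        proof (cases "m = m'")
          case True
          then show ?thesis using diag[of m] by simp
        next
          case False
          then have "(\<Sum>(i, j)\<in>obs_index n p. g m (design_point x p j) * g m' (design_point x p j) / \<sigma>\<^sup>2) = 0"
            using disjoint by (intro sum.neutral) auto
          then show ?thesis by simp
        qed
        \<comment> \<open>The q diagonal entries contribute at most q each, and the summand 1 over
          all pairs gives another q^2.\<close>
        then have "(\<Sum>m<q. \<Sum>m'<q. ?X m m') \<le> (\<Sum>m<q. \<Sum>m'<q. (if m = m' then real q else 0) + 1)"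
          by (intro sum_mono)
        also have "\<dots> = 2 * (real q)\<^sup>2"
          by (simp add: sum.distrib power2_eq_square)
        finally show "(\<Sum>m<q. \<Sum>m'<q. ?X m m') \<le> 2 * (real (card {..<q}))\<^sup>2" by simp
      qed (use assms h g centre \<open>A > 0\<close> in \<open>auto intro!: vec_in_cube simp: q_def lessThan_empty_iff\<close>)
      then have "ennreal (inverse (rate \<alpha> n p) * (A / 4 * w powr \<alpha>)) \<le> worst_risk x \<sigma> \<alpha> L \<beta>\<^sub>0 C n p h"
        by simp
      moreover have "min c1 (A / 4) * w powr \<alpha> \<le> A / 4 * w powr \<alpha>" by (intro mult_right_mono) auto
      ultimately show ?thesis by (intro goal)
    qed
    then show "ennreal (inverse (rate \<alpha> n p) * (c * (ln (real n * real (p_prod p)) / (real n * real (p_prod p)))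
        powr (\<alpha> / (2 * \<alpha> + real CARD('d))))) \<le> worst_risk x \<sigma> \<alpha> L \<beta>\<^sub>0 C n p h"
      by (simp add: N_def e_def d_def)
  qed
qed

theorem theorem2:
  fixes \<alpha> L C\<^sub>Z \<beta>\<^sub>0 \<sigma>\<^sub>0 :: real
    and f :: "'d::finite \<Rightarrow> real \<Rightarrow> real"
    and x :: "'d \<Rightarrow> nat \<Rightarrow> nat \<Rightarrow> real"
  assumes "\<alpha> > 0" and "L > 0" and "C\<^sub>Z > 0" and "0 < \<beta>\<^sub>0" and "\<beta>\<^sub>0 \<le> 1" and "\<sigma>\<^sub>0 > 0"
    and "\<And>k. design_density (f k)"
    and "generated_design f x"
  shows "\<exists>c>0. ennreal c \<le>
    Liminf n_p_at_top (\<lambda>(n, p).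
      INF h\<in>estimators n p.
        SUP (\<mu>, \<Omega>, Z)\<in>hoelder_class \<alpha> L \<times> (process_class \<beta>\<^sub>0 C\<^sub>Z :: 'd field set).
          scaled_risk x \<sigma>\<^sub>0 \<alpha> n p h \<mu> \<Omega> Z)"
proof -
  let ?W = "\<lambda>n p h. worst_risk x \<sigma>\<^sub>0 \<alpha> L \<beta>\<^sub>0 C\<^sub>Z n p h"
  obtain F where "bounded_design f x F" using ex_bounded_design[OF assms(7,8)] by blast
  then interpret bounded_design f x F .
  obtain c1 where c1: "c1 > 0" "\<And>n p h. p_min p \<ge> 1 \<Longrightarrow> h \<in> estimators n p \<Longrightarrow>
      ennreal (inverse (rate \<alpha> n p) * (c1 * real (p_min p) powr - \<alpha>)) \<le> ?W n p h"
    using worst_risk_ge_discretisation[OF assms(1-3,5,6)] by blast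
  obtain c2 where c2: "c2 > 0" "\<And>n p h. n \<ge> 2 \<Longrightarrow> p_min p \<ge> 1 \<Longrightarrow> h \<in> estimators n p \<Longrightarrow>
      ennreal (inverse (rate \<alpha> n p) * (c2 * (ln (real n * real (p_prod p)) / (real n * real (p_prod p)))
        powr (\<alpha> / (2 * \<alpha> + real CARD('d))))) \<le> ?W n p h"
    using worst_risk_ge_noise[OF assms(1-3,5,6)] by blast
  obtain c3 where c3: "c3 > 0" "\<And>n p h. n \<ge> 1 \<Longrightarrow> h \<in> estimators n p \<Longrightarrow>
      ennreal (inverse (rate \<alpha> n p) * (c3 * real n powr (- 1 / 2))) \<le> ?W n p h"
    using worst_risk_ge_root_n[OF assms(2,3,5,6)] by blast
  define c where "c = min c1 (min c2 c3)"
  have "c > 0" using c1 c2 c3 by (simp add: c_def)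
  have bound: "ennreal c \<le> ?W n p h" if n: "n \<ge> 2" and p: "p_min p \<ge> 1" and h: "h \<in> estimators n p" for n p h
  proof -
    have "real n powr (- 1 / 2) \<le> rate \<alpha> n p" unfolding rate_def by (intro Max_ge) auto
    moreover have "real n powr (- 1 / 2) > 0" using n by simp
    ultimately have pos: "rate \<alpha> n p > 0" by linarith
    have *: "ennreal c \<le> ?W n p h"
      if "rate \<alpha> n p = y" "c \<le> c'" "ennreal (inverse (rate \<alpha> n p) * (c' * y)) \<le> ?W n p h" for c' y
    proof -
      have "inverse (rate \<alpha> n p) * (c' * y) = c'" using that(1) pos by simp
      then show ?thesis using that(2,3) by (metis ennreal_leI order_trans)
    qed
    \<comment> \<open>A maximum equals one of its entries, and the bound for that entry cancels the
      scaling exactly.\<close>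
    have "rate \<alpha> n p \<in> {real (p_min p) powr - \<alpha>,
        (ln (real n * real (p_prod p)) / (real n * real (p_prod p))) powr (\<alpha> / (2 * \<alpha> + real CARD('d))),
        real n powr (- 1 / 2)}"
      unfolding rate_def by (rule Max_in) auto
    then consider "rate \<alpha> n p = real (p_min p) powr - \<alpha>"
      | "rate \<alpha> n p = (ln (real n * real (p_prod p)) / (real n * real (p_prod p)))
            powr (\<alpha> / (2 * \<alpha> + real CARD('d)))"
      | "rate \<alpha> n p = real n powr (- 1 / 2)" by blast
    then show ?thesis
    proof cases
      case 1
      then show ?thesis by (rule *[OF _ _ c1(2)[OF p h]]) (simp add: c_def)
    next
      case 2
      then show ?thesis by (rule *[OF _ _ c2(2)[OF n p h]]) (simp add: c_def)
    next
      case 3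
      then show ?thesis by (rule *[OF _ _ c3(2)[OF _ h]]) (use n in \<open>simp_all add: c_def\<close>)
    qed
  qed
  have ev: "\<forall>\<^sub>F np in n_p_at_top. 2 \<le> fst np \<and> 1 \<le> p_min (snd np :: 'd \<Rightarrow> nat)"
    unfolding n_p_at_top_def
    by (intro eventually_prodI eventually_filtercomapI eventually_ge_at_top)
  have "ennreal c \<le> Liminf n_p_at_top (\<lambda>(n, p). INF h\<in>estimators n p. ?W n p h)"
    by (rule Liminf_bounded, rule eventually_mono[OF ev])
       (auto intro!: INF_greatest bound)
  then show ?thesis using \<open>c > 0\<close> unfolding worst_risk_def by blast
qed

end
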